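(* Let $C$ be a locally linear semitopological cone such that every continuous valuation $\nu$ on $C$ has a barycentre $b_\nu$. Then the barycentre map $\beta\colon\mathcal V_wC\to C$, defined by $\beta(\nu)=b_\nu$, is the structure map of a $\mathcal V_w$-algebra (and in particular, $C$ is sober and a topological cone).
   Context: $\mathbb R_+=[0,\infty)$ and $\overline{\mathbb R}_+=[0,\infty]$, both with the Scott topology (proper nonempty opens are the sets of elements $>r$, $r\in\mathbb R_+$). $\mathbf{TOP}_0$ is the category of $T_0$ topological spaces and continuous maps. Valuations. A continuous valuation on a space $X$ with lattice of opens $\mathcal OX$ is a map $\mu\colon\mathcal OX\to\overline{\mathbb R}_+$ with $\mu(\emptyset)=0$, $\mu(U)\le\mu(V)$ if $U\subseteq V$, $\mu(U)+\mu(V)=\mu(U\cup V)+\mu(U\cap V)$, and $\mu(\bigcup_iU_i)=\sup_i\mu(U_i)$ for directed families of opens. $\delta_x(U)=1$ if $x\in U$, and $0$ otherwise. $\mathcal V_wX$ is the set of all continuous valuations on $X$ with the weak topology, generated by the subbasic sets $[U>r]=\{\mu\mid\mu(U)>r\}$, $U\in\mathcal OX$, $r\in\mathbb R_+$. For continuous $h\colon X\to\overline{\mathbb R}_+$ (i.e. $h$ lower semi-continuous), $\int h\,d\mu=\int_0^\infty\mu(h^{-1}((r,\infty]))\,dr$ (Riemann integral). The monad. $\mathcal V_w$ is an endofunctor with $\mathcal V_wf(\mu)(V)=\mu(f^{-1}(V))$; it is a monad with unit $\eta_X(x)=\delta_x$ and multiplication $m_X(\varpi)(U)=\int_{\mu\in\mathcal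 V_wX}\mu(U)\,d\varpi$ for $\varpi\in\mathcal V_w\mathcal V_wX$. A $\mathcal V_w$-algebra (on $\mathbf{TOP}_0$) is a pair $(X,\alpha)$ of a $T_0$ space $X$ and a continuous map $\alpha\colon\mathcal V_wX\to X$ (the structure map) with $\alpha\circ\eta_X=\mathrm{id}_X$ and $\alpha\circ m_X=\alpha\circ\mathcal V_w\alpha$. Cones. A cone is a commutative monoid $(C,+,0)$ with a scalar multiplication $\mathbb R_+\times C\to C$ such that $r(x+y)=rx+ry$, $(r+s)x=rx+sx$, $(rs)x=r(sx)$, $1x=x$, $0x=0$, $r0=0$. A semitopological (resp. topological) cone is a cone with a $T_0$ topology making $+$ and scalar multiplication separately (resp. jointly) continuous. A map $f$ between cones is linear if $f(rx+sy)=rf(x)+sf(y)$ for all $r,s\in\mathbb R_+$; $\overline{\mathbb R}_+$ is a cone with $0\cdot\infty=0$. A subset $A$ of a cone is convex if $ra+(1-r)b\in A$ for all $a,b\in A$, $r\in[0,1]$; it is a half-space if both $A$ and its complement are convex. A cone with a $T_0$ topology is locally linear if it has a subbase of open half-spaces. Barycentres. For a semitopological cone $C$ and a continuous valuation $\nu$ on $C$, a barycentre of $\nu$ is a point $b\in C$ such that $\Lambda(b)=\int\Lambda\,d\nu$ for every linear lower semi-continuous map $\Lambda\colon C\to\overline{\mathbb R}_+$. *)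

theory Defs
  imports "HOL-Analysis.Analysis"
begin

section \<open>Scott topologies on the nonnegative and the extended nonnegative reals\<close>

definition scott_nnreal :: "real topology" where
  "scott_nnreal = topology_generated_by (insert {0..} ((\<lambda>r. {r<..}) ` {0..}))"

definition scott_ennreal :: "ennreal topology" where
  "scott_ennreal = topology_generated_by (insert UNIV ((\<lambda>r. {ennreal r<..}) ` {0..}))"

lemma topspace_scott_nnreal [simp]: "topspace scott_nnreal = {0..}"
  by (auto simp: scott_nnreal_def)

lemma topspace_scott_ennreal [simp]: "topspace scott_ennreal = UNIV"
  by (auto simp: scott_ennreal_def)

lemma openin_scott_nnreal_iff:
  "openin scott_nnreal U \<longleftrightarrow> U = {} \<or> U = {0..} \<or> (\<exists>r\<ge>0. U = {r<..})"
proof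
  assume "openin scott_nnreal U"
  then have "generate_topology_on (insert {0..} ((\<lambda>r::real. {r<..}) ` {0..})) U"
    by (simp add: scott_nnreal_def openin_topology_generated_by_iff)
  then show "U = {} \<or> U = {0..} \<or> (\<exists>r\<ge>0. U = {r<..})"
  proof induction
    case (Int a b)
    show ?case
    proof (cases "a = {} \<or> b = {} \<or> a = {0..} \<or> b = {0..}")
      case True
      have "a \<subseteq> {0..}" "b \<subseteq> {0..}" using Int.IH by force+
      with True have "a \<inter> b = {} \<or> a \<inter> b = a \<or> a \<inter> b = b" by blast
      then show ?thesis using Int.IH by (elim disjE[of "_ = {}"] disjE[of "_ = a"]) simp_all
    next
      case False
      then obtain r s where rs: "0 \<le> r" "0 \<le> s" "a = {r<..}" "b = {s<..}"
        using Int.IH by blast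
      then have "a \<inter> b = {max r s<..}" by auto
      with rs show ?thesis by (intro disjI2 exI[of _ "max r s"]) simp
    qed
  next
    case (UN K)
    show ?case
    proof (cases "{0..} \<in> K")
      case True
      have "A \<subseteq> {0..}" if "A \<in> K" for A
        using UN.IH[OF that] by (elim disjE exE conjE) auto
      then have "\<Union>K \<subseteq> {0..}" by blast
      with True show ?thesis by blast
    next
      case False
      define R where "R = {r. 0 \<le> r \<and> {r<..} \<in> K}"
      have "A \<subseteq> (\<Union>r\<in>R. {r<..})" if A: "A \<in> K" for A
      proof (cases "A = {}")
        case False
        moreover have "A \<noteq> {0..}" using A \<open>{0..} \<notin> K\<close> by blast
        ultimately obtain r where "0 \<le> r" "A = {r<..}" using UN.IH[OF A] by blast
        with A show ?thesis unfolding R_def by blast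
      qed simp
      then have *: "\<Union>K = (\<Union>r\<in>R. {r<..})"
        unfolding R_def by blast
      show ?thesis
      proof (cases "R = {}")
        case True
        with * show ?thesis by auto
      next
        case ne: False
        have bdd: "bdd_below R" by (auto simp: R_def)
        have "(\<Union>r\<in>R. {r<..}) = {Inf R<..}"
          using cInf_less_iff[OF ne bdd] by auto
        moreover have "0 \<le> Inf R"
          using ne by (intro cInf_greatest) (auto simp: R_def)
        ultimately show ?thesis
          using * by (intro disjI2 exI[of _ "Inf R"] conjI) simp_all
      qed
    qed
  next
    case (Basis A)
    then show ?case by (elim insertE imageE) simp_all
  qed simp
next
  show "U = {} \<or> U = {0..} \<or> (\<exists>r\<ge>0. U = {r<..}) \<Longrightarrow> openin scott_nnreal U"
    unfolding scott_nnreal_def openin_topology_generated_by_iff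
    by (elim disjE exE conjE)
       (simp_all add: generate_topology_on.Empty generate_topology_on.Basis)
qed

lemma openin_scott_ennreal_iff:
  "openin scott_ennreal U \<longleftrightarrow> U = {} \<or> U = UNIV \<or> (\<exists>r\<ge>0. U = {ennreal r<..})"
proof
  assume "openin scott_ennreal U"
  then have "generate_topology_on (insert UNIV ((\<lambda>r. {ennreal r<..}) ` {0..})) U"
    by (simp add: scott_ennreal_def openin_topology_generated_by_iff)
  then show "U = {} \<or> U = UNIV \<or> (\<exists>r\<ge>0. U = {ennreal r<..})"
  proof induction
    case (Int a b)
    show ?case
    proof (cases "a = {} \<or> b = {} \<or> a = UNIV \<or> b = UNIV")
      case True
      then have "a \<inter> b = {} \<or> a \<inter> b = a \<or> a \<inter> b = b" by blast
      then show ?thesis using Int.IH by (elim disjE[of "_ = {}"] disjE[of "_ = a"]) simp_all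
    next
      case False
      then obtain r s where rs: "0 \<le> r" "0 \<le> s" "a = {ennreal r<..}" "b = {ennreal s<..}"
        using Int.IH by blast
      have "a \<inter> b = {max (ennreal r) (ennreal s)<..}" using rs by auto
      also have "max (ennreal r) (ennreal s) = ennreal (max r s)"
        using rs by (simp add: max_def ennreal_le_iff)
      finally show ?thesis using rs by (intro disjI2 exI[of _ "max r s"]) simp
    qed
  next
    case (UN K)
    show ?case
    proof (cases "UNIV \<in> K")
      case True
      then show ?thesis by blast
    next
      case False
      define R where "R = {r. 0 \<le> r \<and> {ennreal r<..} \<in> K}"
      have "A \<subseteq> (\<Union>r\<in>R. {ennreal r<..})" if A: "A \<in> K" for A
      proof (cases "A = {}")
        case False
        moreover have "A \<noteq> UNIV" using A \<open>UNIV \<notin> K\<close> by blast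
        ultimately obtain r where "0 \<le> r" "A = {ennreal r<..}" using UN.IH[OF A] by blast
        with A show ?thesis unfolding R_def by blast
      qed simp
      then have *: "\<Union>K = (\<Union>r\<in>R. {ennreal r<..})"
        unfolding R_def by blast
      show ?thesis
      proof (cases "R = {}")
        case True
        with * show ?thesis by auto
      next
        case ne: False
        have un: "(\<Union>r\<in>R. {ennreal r<..}) = {(INF r\<in>R. ennreal r)<..}"
          by (auto simp: INF_less_iff)
        obtain r0 where "r0 \<in> R" using ne by blast
        then have "(INF r\<in>R. ennreal r) \<le> ennreal r0" by (rule INF_lower)
        then have "(INF r\<in>R. ennreal r) < top"
          using ennreal_less_top le_less_trans by blast
        then obtain s where "0 \<le> s" "(INF r\<in>R. ennreal r) = ennreal s"
          by (cases "INF r\<in>R. ennreal r") auto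
        with * un show ?thesis by (intro disjI2 exI[of _ s] conjI) simp_all
      qed
    qed
  next
    case (Basis A)
    then show ?case by (elim insertE imageE) auto
  qed simp
next
  show "U = {} \<or> U = UNIV \<or> (\<exists>r\<ge>0. U = {ennreal r<..}) \<Longrightarrow> openin scott_ennreal U"
    unfolding scott_ennreal_def openin_topology_generated_by_iff
    by (elim disjE exE conjE)
       (simp_all add: generate_topology_on.Empty generate_topology_on.Basis)
qed


section \<open>Sober spaces\<close>

definition irreducible_closedin :: "'a topology \<Rightarrow> 'a set \<Rightarrow> bool" where
  "irreducible_closedin X F \<longleftrightarrow> closedin X F \<and> F \<noteq> {} \<and>
     (\<forall>A B. closedin X A \<and> closedin X B \<and> F \<subseteq> A \<union> B \<longrightarrow> F \<subseteq> A \<or> F \<subseteq> B)"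

definition sober_space :: "'a topology \<Rightarrow> bool" where
  "sober_space X \<longleftrightarrow>
     (\<forall>F. irreducible_closedin X F \<longrightarrow> (\<exists>!x. x \<in> topspace X \<and> F = X closure_of {x}))"


section \<open>Continuous valuations\<close>

definition directed_family :: "'a set set \<Rightarrow> bool" where
  "directed_family D \<longleftrightarrow> D \<noteq> {} \<and> (\<forall>U\<in>D. \<forall>V\<in>D. \<exists>W\<in>D. U \<subseteq> W \<and> V \<subseteq> W)"

text \<open>Valuations live on open sets only; extensionality (the value is \<open>undefined\<close> on
  non-open sets) makes equality of functions coincide with equality of valuations.\<close>

definition continuous_valuations :: "'a topology \<Rightarrow> ('a set \<Rightarrow> ennreal) set" where
  "continuous_valuations X = {\<mu> \<in> extensional {U. openin X U}.
     \<mu> {} = 0 \<and>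
     (\<forall>U V. openin X U \<and> openin X V \<and> U \<subseteq> V \<longrightarrow> \<mu> U \<le> \<mu> V) \<and>
     (\<forall>U V. openin X U \<and> openin X V \<longrightarrow> \<mu> U + \<mu> V = \<mu> (U \<union> V) + \<mu> (U \<inter> V)) \<and>
     (\<forall>D. directed_family D \<and> (\<forall>U\<in>D. openin X U) \<longrightarrow> \<mu> (\<Union>D) = (SUP U\<in>D. \<mu> U))}"

definition dirac_valuation :: "'a topology \<Rightarrow> 'a \<Rightarrow> 'a set \<Rightarrow> ennreal" where
  "dirac_valuation X x = (\<lambda>U\<in>{U. openin X U}. if x \<in> U then 1 else 0)"

text \<open>The full set of valuations is put into the generating family because the sets
  \<open>[U > r]\<close> never contain the zero valuation, whereas the carrier of a
  \<^const>\<open>topology_generated_by\<close> is the union of the family.\<close>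

definition Vw :: "'a topology \<Rightarrow> ('a set \<Rightarrow> ennreal) topology" where
  "Vw X = topology_generated_by (insert (continuous_valuations X)
     {{\<mu> \<in> continuous_valuations X. ennreal r < \<mu> U} | U r. openin X U \<and> 0 \<le> r})"

lemma topspace_Vw [simp]: "topspace (Vw X) = continuous_valuations X"
  by (auto simp: Vw_def)

text \<open>The integrand below is antitone in \<open>r\<close>, so that its Lebesgue integral is its
  (improper) Riemann integral, with value \<open>\<infinity>\<close> in case of divergence;
  see \<open>valuation_integral_eq_SUP_dyadic\<close>.\<close>

definition valuation_integral ::
    "'a topology \<Rightarrow> ('a set \<Rightarrow> ennreal) \<Rightarrow> ('a \<Rightarrow> ennreal) \<Rightarrow> ennreal" where
  "valuation_integral X \<mu> h = (\<integral>\<^sup>+ r\<in>{0..}. \<mu> {x \<in> topspace X. ennreal r < h x} \<partial>lborel)"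

lemma nn_integral_antimono_eq_SUP_dyadic:
  fixes f :: "real \<Rightarrow> ennreal"
  assumes anti: "\<And>r s. 0 \<le> r \<Longrightarrow> r \<le> s \<Longrightarrow> f s \<le> f r"
    and right: "\<And>r. 0 \<le> r \<Longrightarrow> f r = (SUP s\<in>{r<..}. f s)"
  shows "(\<integral>\<^sup>+ r\<in>{0..}. f r \<partial>lborel)
       = (SUP n. \<Sum>k<n * 2 ^ n. f (real (Suc k) / 2 ^ n) * ennreal (1 / 2 ^ n))"
proof -
  define J where "J n k = {real k / 2 ^ n ..< real (Suc k) / 2 ^ n}" for n k :: nat
  define g where "g n r = (\<Sum>k<n * 2 ^ n. f (real (Suc k) / 2 ^ n) * indicator (J n k) r)"
    for n :: nat and r :: real
  define c where "c n r = nat \<lfloor>2 ^ n * r\<rfloor>" for n :: nat and r :: real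
  have J_iff: "r \<in> J n k \<longleftrightarrow> k = c n r" if "0 \<le> r" for n k r
  proof -
    have "r \<in> J n k \<longleftrightarrow> real k \<le> 2 ^ n * r \<and> 2 ^ n * r < real k + 1"
      by (auto simp: J_def field_simps)
    also have "\<dots> \<longleftrightarrow> \<lfloor>2 ^ n * r\<rfloor> = int k"
      by (simp add: floor_eq_iff)
    also have "\<dots> \<longleftrightarrow> k = c n r"
      using that by (auto simp: c_def)
    finally show ?thesis .
  qed
  have c_less: "c n r < n * 2 ^ n \<longleftrightarrow> r < real n" if "0 \<le> r" for n r
  proof -
    have "c n r < n * 2 ^ n \<longleftrightarrow> 2 ^ n * r < real (n * 2 ^ n)"
      using that by (auto simp: c_def nat_less_iff floor_less_iff)
    also have "\<dots> \<longleftrightarrow> r < real n" by (simp add: mult.commute)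
    finally show ?thesis .
  qed
  have g_pos: "g n r = (if r < real n then f (real (Suc (c n r)) / 2 ^ n) else 0)"
    if "0 \<le> r" for n r
  proof -
    have "g n r = (\<Sum>k<n * 2 ^ n. if k = c n r then f (real (Suc k) / 2 ^ n) else 0)"
      unfolding g_def by (intro sum.cong) (auto simp: J_iff[OF that] indicator_def)
    then show ?thesis by (simp add: sum.delta c_less[OF that])
  qed
  have g_neg: "g n r = 0" if "r < 0" for n r
  proof -
    have "r \<notin> J n k" for k
    proof -
      have "0 \<le> real k / 2 ^ n" by simp
      then have "\<not> real k / 2 ^ n \<le> r" using that by linarith
      then show ?thesis unfolding J_def by simp
    qed
    then show ?thesis by (simp add: g_def)
  qed
  have c_bounds: "2 ^ n * r < real (Suc (c n r))" "real (Suc (c n r)) \<le> 2 ^ n * r + 1"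
    if "0 \<le> r" for n r
  proof -
    have "real (c n r) = of_int \<lfloor>2 ^ n * r\<rfloor>"
      using that by (simp add: c_def)
    then show "2 ^ n * r < real (Suc (c n r))" "real (Suc (c n r)) \<le> 2 ^ n * r + 1"
      by linarith+
  qed
  have g_Suc: "g n r \<le> g (Suc n) r" for n r
  proof (cases "0 \<le> r \<and> r < real n")
    case True
    have "c (Suc n) r \<le> 2 * c n r + 1"
    proof -
      have "\<lfloor>2 * (2 ^ n * r)\<rfloor> \<le> 2 * \<lfloor>2 ^ n * r\<rfloor> + 1" by linarith
      then show ?thesis using True by (simp add: c_def mult.assoc)
    qed
    then have "real (Suc (c (Suc n) r)) \<le> real (2 * Suc (c n r))"
      by (subst of_nat_le_iff) simp
    then have "real (Suc (c (Suc n) r)) / 2 ^ Suc n \<le> real (Suc (c n r)) / 2 ^ n"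
      by (simp add: divide_simps del: of_nat_Suc) (simp add: algebra_simps)
    then have "f (real (Suc (c n r)) / 2 ^ n) \<le> f (real (Suc (c (Suc n) r)) / 2 ^ Suc n)"
      by (intro anti) auto
    moreover have "r < real (Suc n)" using True by simp
    ultimately show ?thesis using True by (simp add: g_pos del: of_nat_Suc power_Suc)
  next
    case False
    then show ?thesis by (cases "0 \<le> r") (auto simp: g_pos g_neg)
  qed
  have g_SUP: "f r * indicator {0..} r = (SUP n. g n r)" for r
  proof (cases "0 \<le> r")
    case True
    have "(SUP n. g n r) = f r"
    proof (rule antisym)
      have "g n r \<le> f r" for n
      proof -
        have "r \<le> real (Suc (c n r)) / 2 ^ n"
          using c_bounds(1)[OF True, of n] by (simp add: field_simps)
        from anti[OF True this] show ?thesis using True by (simp add: g_pos)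
      qed
      then show "(SUP n. g n r) \<le> f r" by (intro SUP_least)
      have "f s \<le> (SUP n. g n r)" if "r < s" for s
      proof -
        have "0 < s - r" "(1 / 2 :: real) < 1" using that by simp_all
        then obtain m where m: "(1 / 2) ^ m < s - r" using real_arch_pow_inv by blast
        obtain l where l: "r < real l" using reals_Archimedean2 by blast
        define n where "n = max m l"
        have "(1 / 2 :: real) ^ n \<le> (1 / 2) ^ m"
          by (intro power_decreasing) (auto simp: n_def)
        then have n: "1 / 2 ^ n < s - r" using m by (simp add: power_divide)
        have rn: "r < real n" using l by (simp add: n_def)
        have "real (Suc (c n r)) / 2 ^ n \<le> (2 ^ n * r + 1) / 2 ^ n"
          using c_bounds(2)[OF True, of n] by (intro divide_right_mono) auto
        also have "\<dots> = r + 1 / 2 ^ n" by (simp add: field_simps)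
        also have "\<dots> \<le> s" using n by simp
        finally have "f s \<le> f (real (Suc (c n r)) / 2 ^ n)" by (intro anti) auto
        also have "\<dots> = g n r" using rn True by (simp add: g_pos)
        also have "\<dots> \<le> (SUP n. g n r)" by (intro SUP_upper) auto
        finally show ?thesis .
      qed
      then show "f r \<le> (SUP n. g n r)"
        by (subst right[OF True]) (intro SUP_least, auto)
    qed
    then show ?thesis using True by simp
  next
    case False
    then show ?thesis by (simp add: g_neg)
  qed
  have meas [measurable]: "g n \<in> borel_measurable lborel" for n
    unfolding g_def J_def by measurable
  have "(\<integral>\<^sup>+ r\<in>{0..}. f r \<partial>lborel) = (\<integral>\<^sup>+ r. (SUP n. g n r) \<partial>lborel)"
    by (simp add: g_SUP)
  also have "\<dots> = (SUP n. \<integral>\<^sup>+ r. g n r \<partial>lborel)"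
    by (intro nn_integral_monotone_convergence_SUP)
       (auto intro!: incseq_SucI le_funI g_Suc)
  also have "(\<lambda>n. \<integral>\<^sup>+ r. g n r \<partial>lborel)
           = (\<lambda>n. \<Sum>k<n * 2 ^ n. f (real (Suc k) / 2 ^ n) * ennreal (1 / 2 ^ n))"
  proof
    fix n
    have e: "emeasure lborel (J n k) = ennreal (1 / 2 ^ n)" for k
      by (simp add: J_def divide_right_mono) (simp add: field_simps)
    have J: "J n k \<in> sets lborel" for k by (simp add: J_def)
    have "(\<integral>\<^sup>+ r. g n r \<partial>lborel)
        = (\<Sum>k<n * 2 ^ n. \<integral>\<^sup>+ r. f (real (Suc k) / 2 ^ n) * indicator (J n k) r \<partial>lborel)"
      unfolding g_def
      by (rule nn_integral_sum)
         (intro borel_measurable_times_ennreal borel_measurable_indicator J borel_measurable_const)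
    then show "(\<integral>\<^sup>+ r. g n r \<partial>lborel)
        = (\<Sum>k<n * 2 ^ n. f (real (Suc k) / 2 ^ n) * ennreal (1 / 2 ^ n))"
      by (simp only: nn_integral_cmult_indicator[OF J] e)
  qed
  finally show ?thesis .
qed

lemma valuation_integral_eq_SUP_dyadic:
  assumes \<mu>: "\<mu> \<in> continuous_valuations X" and h: "continuous_map X scott_ennreal h"
  shows "valuation_integral X \<mu> h =
    (SUP n. \<Sum>k<n * 2 ^ n.
       \<mu> {x \<in> topspace X. ennreal (real (Suc k) / 2 ^ n) < h x} * ennreal (1 / 2 ^ n))"
proof -
  define U where "U r = {x \<in> topspace X. ennreal r < h x}" for r
  have op: "openin X (U r)" if "0 \<le> r" for r
  proof -
    have "openin scott_ennreal {ennreal r<..}"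
      using that by (auto simp: openin_scott_ennreal_iff)
    from openin_continuous_map_preimage[OF h this] show ?thesis by (simp add: U_def)
  qed
  have U_mono: "U s \<subseteq> U r" if "r \<le> s" for r s
    using ennreal_leI[OF that] by (auto simp: U_def)
  have mono: "\<mu> A \<le> \<mu> B" if "openin X A" "openin X B" "A \<subseteq> B" for A B
    using \<mu> that by (auto simp: continuous_valuations_def)
  have cont: "\<mu> (\<Union>D) = (SUP V\<in>D. \<mu> V)" if "directed_family D" "\<And>V. V \<in> D \<Longrightarrow> openin X V" for D
    using \<mu> that by (auto simp: continuous_valuations_def)
  have right: "\<mu> (U r) = (SUP s\<in>{r<..}. \<mu> (U s))" if "0 \<le> r" for r
  proof -
    have "U r \<subseteq> (\<Union>s\<in>{r<..}. U s)"
    proof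
      fix x assume x: "x \<in> U r"
      then obtain q where q: "ennreal r < q" "q < h x" using dense by (auto simp: U_def)
      then have "q < top" using top.not_eq_extremum by fastforce
      then obtain s where "0 \<le> s" "q = ennreal s" by (cases q) auto
      with q x that show "x \<in> (\<Union>s\<in>{r<..}. U s)"
        by (auto simp: U_def ennreal_less_iff)
    qed
    moreover have "(\<Union>s\<in>{r<..}. U s) \<subseteq> U r" 
      by (intro UN_least U_mono) simp
    ultimately have eq: "U r = \<Union>(U ` {r<..})" by auto
    have dir: "directed_family (U ` {r<..})"
      unfolding directed_family_def
    proof (intro conjI ballI)
      show "U ` {r<..} \<noteq> {}" by simp
      fix A B assume "A \<in> U ` {r<..}" "B \<in> U ` {r<..}"
      then obtain s t where "r < s" "r < t" "A = U s" "B = U t" by auto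
      then show "\<exists>W\<in>U ` {r<..}. A \<subseteq> W \<and> B \<subseteq> W"
        using U_mono[of "min s t"] by (intro bexI[of _ "U (min s t)"]) auto
    qed
    have "\<mu> (\<Union>(U ` {r<..})) = (SUP V\<in>U ` {r<..}. \<mu> V)"
      using dir that by (intro cont) (auto intro!: op)
    then show ?thesis by (simp add: eq[symmetric] image_comp comp_def)
  qed
  show ?thesis
    unfolding valuation_integral_def U_def[symmetric]
  proof (rule nn_integral_antimono_eq_SUP_dyadic)
    show "\<mu> (U s) \<le> \<mu> (U r)" if "0 \<le> r" "r \<le> s" for r s
      using that by (intro mono op U_mono) auto
  qed (rule right)
qed


section \<open>The monad of continuous valuations and its algebras\<close>

definition Vw_map ::
    "'a topology \<Rightarrow> 'b topology \<Rightarrow> ('a \<Rightarrow> 'b) \<Rightarrow> ('a set \<Rightarrow> ennreal) \<Rightarrow> 'b set \<Rightarrow> ennreal" where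
  "Vw_map X Y f \<mu> = (\<lambda>V\<in>{V. openin Y V}. \<mu> {x \<in> topspace X. f x \<in> V})"

definition Vw_mult :: "'a topology \<Rightarrow> (('a set \<Rightarrow> ennreal) set \<Rightarrow> ennreal) \<Rightarrow> 'a set \<Rightarrow> ennreal" where
  "Vw_mult X \<omega> = (\<lambda>U\<in>{U. openin X U}. valuation_integral (Vw X) \<omega> (\<lambda>\<mu>. \<mu> U))"

definition Vw_algebra :: "'a topology \<Rightarrow> (('a set \<Rightarrow> ennreal) \<Rightarrow> 'a) \<Rightarrow> bool" where
  "Vw_algebra X \<alpha> \<longleftrightarrow> t0_space X \<and> continuous_map (Vw X) X \<alpha> \<and>
     (\<forall>x\<in>topspace X. \<alpha> (dirac_valuation X x) = x) \<and>
     (\<forall>\<omega>\<in>topspace (Vw (Vw X)). \<alpha> (Vw_mult X \<omega>) = \<alpha> (Vw_map (Vw X) X \<alpha> \<omega>))"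


section \<open>Cones\<close>

text \<open>The scalars are the nonnegative reals: the values of \<open>smul\<close> at negative reals are
  irrelevant and unconstrained.\<close>

locale rplus_cone =
  fixes C :: "'a set" and add :: "'a \<Rightarrow> 'a \<Rightarrow> 'a" and zero :: 'a and smul :: "real \<Rightarrow> 'a \<Rightarrow> 'a"
  assumes add_closed: "x \<in> C \<Longrightarrow> y \<in> C \<Longrightarrow> add x y \<in> C"
    and zero_closed: "zero \<in> C"
    and smul_closed: "0 \<le> r \<Longrightarrow> x \<in> C \<Longrightarrow> smul r x \<in> C"
    and add_assoc: "x \<in> C \<Longrightarrow> y \<in> C \<Longrightarrow> z \<in> C \<Longrightarrow> add (add x y) z = add x (add y z)"
    and add_commute: "x \<in> C \<Longrightarrow> y \<in> C \<Longrightarrow> add x y = add y x"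
    and add_zero: "x \<in> C \<Longrightarrow> add zero x = x"
    and smul_add: "0 \<le> r \<Longrightarrow> x \<in> C \<Longrightarrow> y \<in> C \<Longrightarrow>
          smul r (add x y) = add (smul r x) (smul r y)"
    and add_smul: "0 \<le> r \<Longrightarrow> 0 \<le> s \<Longrightarrow> x \<in> C \<Longrightarrow>
          smul (r + s) x = add (smul r x) (smul s x)"
    and smul_smul: "0 \<le> r \<Longrightarrow> 0 \<le> s \<Longrightarrow> x \<in> C \<Longrightarrow> smul (r * s) x = smul r (smul s x)"
    and one_smul: "x \<in> C \<Longrightarrow> smul 1 x = x"
    and zero_smul: "x \<in> C \<Longrightarrow> smul 0 x = zero"
    and smul_zero: "0 \<le> r \<Longrightarrow> smul r zero = zero"

definition semitopological_cone ::
    "'a topology \<Rightarrow> ('a \<Rightarrow> 'a \<Rightarrow> 'a) \<Rightarrow> 'a \<Rightarrow> (real \<Rightarrow> 'a \<Rightarrow> 'a) \<Rightarrow> bool" where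
  "semitopological_cone X add zero smul \<longleftrightarrow>
     rplus_cone (topspace X) add zero smul \<and> t0_space X \<and>
     (\<forall>a\<in>topspace X. continuous_map X X (\<lambda>x. add a x)) \<and>
     (\<forall>a\<in>topspace X. continuous_map X X (\<lambda>x. add x a)) \<and>
     (\<forall>r\<ge>0. continuous_map X X (\<lambda>x. smul r x)) \<and>
     (\<forall>x\<in>topspace X. continuous_map scott_nnreal X (\<lambda>r. smul r x))"

definition topological_cone ::
    "'a topology \<Rightarrow> ('a \<Rightarrow> 'a \<Rightarrow> 'a) \<Rightarrow> 'a \<Rightarrow> (real \<Rightarrow> 'a \<Rightarrow> 'a) \<Rightarrow> bool" where
  "topological_cone X add zero smul \<longleftrightarrow>
     rplus_cone (topspace X) add zero smul \<and> t0_space X \<and>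
     continuous_map (prod_topology X X) X (\<lambda>(x, y). add x y) \<and>
     continuous_map (prod_topology scott_nnreal X) X (\<lambda>(r, x). smul r x)"

definition cone_convex :: "('a \<Rightarrow> 'a \<Rightarrow> 'a) \<Rightarrow> (real \<Rightarrow> 'a \<Rightarrow> 'a) \<Rightarrow> 'a set \<Rightarrow> bool" where
  "cone_convex add smul A \<longleftrightarrow>
     (\<forall>a\<in>A. \<forall>b\<in>A. \<forall>r\<in>{0..1}. add (smul r a) (smul (1 - r) b) \<in> A)"

definition half_space :: "'a set \<Rightarrow> ('a \<Rightarrow> 'a \<Rightarrow> 'a) \<Rightarrow> (real \<Rightarrow> 'a \<Rightarrow> 'a) \<Rightarrow> 'a set \<Rightarrow> bool" where
  "half_space C add smul A \<longleftrightarrow>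
     A \<subseteq> C \<and> cone_convex add smul A \<and> cone_convex add smul (C - A)"

text \<open>The whole cone is an open half-space, so it makes no difference that the members of a
  generating family have to cover the space here.\<close>

definition locally_linear_cone ::
    "'a topology \<Rightarrow> ('a \<Rightarrow> 'a \<Rightarrow> 'a) \<Rightarrow> 'a \<Rightarrow> (real \<Rightarrow> 'a \<Rightarrow> 'a) \<Rightarrow> bool" where
  "locally_linear_cone X add zero smul \<longleftrightarrow>
     rplus_cone (topspace X) add zero smul \<and> t0_space X \<and>
     (\<exists>\<S>. (\<forall>A\<in>\<S>. openin X A \<and> half_space (topspace X) add smul A) \<and>
          X = topology_generated_by \<S>)"

definition linear_to_ennreal ::
    "'a set \<Rightarrow> ('a \<Rightarrow> 'a \<Rightarrow> 'a) \<Rightarrow> (real \<Rightarrow> 'a \<Rightarrow> 'a) \<Rightarrow> ('a \<Rightarrow> ennreal) \<Rightarrow> bool" where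
  "linear_to_ennreal C add smul f \<longleftrightarrow>
     (\<forall>x\<in>C. \<forall>y\<in>C. \<forall>r\<ge>0. \<forall>s\<ge>0.
        f (add (smul r x) (smul s y)) = ennreal r * f x + ennreal s * f y)"

definition is_barycentre ::
    "'a topology \<Rightarrow> ('a \<Rightarrow> 'a \<Rightarrow> 'a) \<Rightarrow> (real \<Rightarrow> 'a \<Rightarrow> 'a) \<Rightarrow> ('a set \<Rightarrow> ennreal) \<Rightarrow> 'a \<Rightarrow> bool" where
  "is_barycentre X add smul \<nu> b \<longleftrightarrow> b \<in> topspace X \<and>
     (\<forall>\<Lambda>. linear_to_ennreal (topspace X) add smul \<Lambda> \<and> continuous_map X scott_ennreal \<Lambda> \<longrightarrow>
          \<Lambda> b = valuation_integral X \<nu> \<Lambda>)"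

end

theory Submission
  imports Defs
begin

text \<open>An open half-space \<open>H\<close> that misses the zero is \<open>{\<Lambda> > 1}\<close> for its gauge
  \<open>\<Lambda> x = sup {a > 0. x / a \<in> H}\<close>: convexity of \<open>H\<close> makes \<open>\<Lambda>\<close> superadditive, convexity of the
  complement makes it subadditive, and openness along rays makes it lower semi-continuous; an open
  set that contains the zero is the whole cone. So the linear lower semi-continuous maps generate
  the topology and separate points, and everything reduces to evaluating them. Continuity of
  \<open>\<beta>\<close> is lower semi-continuity of \<open>\<nu> \<mapsto> \<integral>\<Lambda> d\<nu>\<close>, and the algebra law for the multiplication
  is the exchange \<open>\<integral>\<Lambda> d(m \<omega>) = \<integral>(\<integral>\<Lambda> d\<nu>) d\<omega>\<close>, which rests on additivity and directed
  continuity of the integral. For sobriety, an irreducible closed set \<open>F\<close> defines the valuation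
  with value \<open>1\<close> on the open sets that meet \<open>F\<close>, and its barycentre is the generic point
  of \<open>F\<close>.\<close>

section \<open>Lower semi-continuous maps\<close>

lemma continuous_map_scott_ennreal_iff:
  "continuous_map X scott_ennreal f \<longleftrightarrow>
     (\<forall>r\<ge>0. openin X {x \<in> topspace X. ennreal r < f x})"
proof
  assume f: "continuous_map X scott_ennreal f"
  show "\<forall>r\<ge>0. openin X {x \<in> topspace X. ennreal r < f x}"
  proof (intro allI impI)
    fix r :: real assume "0 \<le> r"
    then have "openin scott_ennreal {ennreal r<..}"
      by (auto simp: openin_scott_ennreal_iff)
    from openin_continuous_map_preimage[OF f this]
    show "openin X {x \<in> topspace X. ennreal r < f x}" by simp
  qed
next
  assume *: "\<forall>r\<ge>0. openin X {x \<in> topspace X. ennreal r < f x}"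
  show "continuous_map X scott_ennreal f"
    unfolding continuous_map_def by (auto simp: openin_scott_ennreal_iff *)
qed

lemmas openin_superlevel = continuous_map_scott_ennreal_iff[THEN iffD1, rule_format]

lemma ennreal_less_obtain:
  assumes "x < (y :: ennreal)"
  obtains r where "0 \<le> r" "x < ennreal r" "ennreal r < y"
proof -
  obtain q where q: "x < q" "q < y" using assms dense by blast
  then have "q < top" using top.not_eq_extremum by fastforce
  then show ?thesis using q that by (cases q) auto
qed

text \<open>If \<open>x\<close> exceeded \<open>y\<close>, a real level would lie strictly between
  them, and it is positive because it exceeds \<open>y\<close>. Positive levels are those at which
  \<open>less_cone_gauge_iff\<close> describes a gauge.\<close>

lemma ennreal_superlevel_leI:
  assumes "\<And>r. 0 < r \<Longrightarrow> ennreal r < x \<Longrightarrow> ennreal r \<le> y"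
  shows "x \<le> y"
proof (rule ccontr)
  assume "\<not> x \<le> y"
  then obtain r where r: "0 \<le> r" "y < ennreal r" "ennreal r < x"
    by (auto simp: not_le elim: ennreal_less_obtain)
  then have "0 < r" by (auto simp: less_le)
  then show False using assms r by (meson leD)
qed

text \<open>The two negated hypotheses make both summands at most \<open>x\<close>, hence finite,
  and both positive, so each can be lowered a little.\<close>

lemma ennreal_less_add_obtain:
  assumes "x < y + (z :: ennreal)" "x < top"
  assumes "\<not> x < y" "\<not> x < z"
  obtains a b where "0 \<le> a" "0 \<le> b" "ennreal a < y" "ennreal b < z" "x < ennreal a + ennreal b"
proof -
  have yz: "0 < y" "0 < z" using assms by (auto simp: not_less intro: ccontr)
  have "y < top" "z < top" using assms by (auto simp: not_less top.not_eq_extremum[symmetric] top_unique)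
  then obtain u v where u: "0 \<le> u" "y = ennreal u" and v: "0 \<le> v" "z = ennreal v"
    by (cases y; cases z) auto
  obtain w where w: "0 \<le> w" "x = ennreal w" using assms(2) by (cases x) auto
  have lt: "w < u + v" using assms(1) u v w by (simp add: ennreal_less_iff flip: ennreal_plus)
  have pos: "0 < u" "0 < v" using yz u v by auto
  \<comment> \<open>Lowering both summands by at most a third of the slack \<open>u + v - w\<close>
    uses up at most two thirds of it; the bounds \<open>u\<close> and \<open>v\<close> keep the new
    levels nonnegative.\<close>
  define d where "d = min (min u v) ((u + v - w) / 3)"
  have d: "0 < d" "d \<le> u" "d \<le> v" "d \<le> (u + v - w) / 3" using lt pos
    unfolding d_def by (simp_all only: min_less_iff_conj) (auto simp: min_def)
  show ?thesis
  proof (rule that[of "u - d" "v - d"])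
    show "x < ennreal (u - d) + ennreal (v - d)"
      using d lt w by (simp add: ennreal_less_iff flip: ennreal_plus)
  qed (use d u v in \<open>auto simp: ennreal_less_iff\<close>)
qed

lemma continuous_map_scott_ennreal_add:
  assumes f: "continuous_map X scott_ennreal f" and g: "continuous_map X scott_ennreal g"
  shows "continuous_map X scott_ennreal (\<lambda>x. f x + g x)"
  unfolding continuous_map_scott_ennreal_iff
proof (intro allI impI)
  fix r :: real assume r: "0 \<le> r"
  define F where "F a = {x \<in> topspace X. ennreal a < f x}" for a
  define G where "G a = {x \<in> topspace X. ennreal a < g x}" for a
  define I where "I = {(a, b). 0 \<le> a \<and> 0 \<le> b \<and> r < a + b}"
  \<comment> \<open>\<open>F r\<close> and \<open>G r\<close> collect the points where one summand
    alone exceeds \<open>r\<close>. The pairs in \<open>I\<close> do not catch all of these: where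
    \<open>g x = 0\<close>, no \<open>b \<ge> 0\<close> lies strictly below
    \<open>g x\<close>.\<close>
  have "openin X (F r \<union> G r \<union> (\<Union>(a, b)\<in>I. F a \<inter> G b))"
    using r by (intro openin_Un openin_Union)
      (auto simp: F_def G_def I_def intro!: openin_superlevel[OF f] openin_superlevel[OF g])
  also have "F r \<union> G r \<union> (\<Union>(a, b)\<in>I. F a \<inter> G b) = {x \<in> topspace X. ennreal r < f x + g x}"
  proof (intro equalityI subsetI)
    fix x assume "x \<in> F r \<union> G r \<union> (\<Union>(a, b)\<in>I. F a \<inter> G b)"
    then consider "x \<in> F r" | "x \<in> G r" | a b where "(a, b) \<in> I" "x \<in> F a" "x \<in> G b" by blast
    then show "x \<in> {x \<in> topspace X. ennreal r < f x + g x}"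
    proof cases
      case 3
      have "ennreal r < ennreal (a + b)"
        using 3 r by (auto simp: I_def ennreal_less_iff simp del: ennreal_plus)
      also have "\<dots> \<le> f x + g x"
        using 3 by (auto simp: I_def F_def G_def intro!: add_mono)
      finally show ?thesis using 3 by (simp add: F_def)
    qed (auto simp: F_def G_def intro: less_le_trans add_increasing add_increasing2)
  next
    fix x assume x: "x \<in> {x \<in> topspace X. ennreal r < f x + g x}"
    show "x \<in> F r \<union> G r \<union> (\<Union>(a, b)\<in>I. F a \<inter> G b)"
    proof (cases "ennreal r < f x \<or> ennreal r < g x")
      case True
      then show ?thesis using x by (auto simp: F_def G_def)
    next
      case False
      then obtain a b where ab: "0 \<le> a" "0 \<le> b" "ennreal a < f x" "ennreal b < g x"
        "ennreal r < ennreal a + ennreal b"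
        using x ennreal_less_add_obtain[of "ennreal r" "f x" "g x"] by auto
      then have "r < a + b" using r by (simp add: ennreal_less_iff flip: ennreal_plus)
      then show ?thesis using ab x by (auto simp: F_def G_def I_def)
    qed
  qed
  finally show "openin X {x \<in> topspace X. ennreal r < f x + g x}" .
qed

lemma continuous_map_scott_ennreal_sum:
  assumes "\<And>i. i \<in> I \<Longrightarrow> continuous_map X scott_ennreal (f i)"
  shows "continuous_map X scott_ennreal (\<lambda>x. \<Sum>i\<in>I. f i x)"
  using assms
  by (induction I rule: infinite_finite_induct) (auto intro!: continuous_map_scott_ennreal_add)

lemma ennreal_less_mult_left_iff:
  assumes "0 < c"
  shows "ennreal r < ennreal c * y \<longleftrightarrow> ennreal (r / c) < y"
proof (cases y)
  case (real u)
  then show ?thesis using assms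
    by (cases "0 \<le> r") (auto simp: ennreal_less_iff field_simps ennreal_neg divide_neg_pos simp flip: ennreal_mult')
qed (use assms in \<open>auto simp: ennreal_mult_top\<close>)

lemma continuous_map_scott_ennreal_cmult:
  assumes f: "continuous_map X scott_ennreal f"
  shows "continuous_map X scott_ennreal (\<lambda>x. ennreal c * f x)"
proof (cases "0 < c")
  case True
  then show ?thesis unfolding continuous_map_scott_ennreal_iff ennreal_less_mult_left_iff[OF True]
    by (auto intro!: openin_superlevel[OF f])
next
  case False
  then show ?thesis by (simp add: ennreal_neg)
qed

lemma continuous_map_scott_ennreal_SUP:
  assumes f: "\<And>i. i \<in> I \<Longrightarrow> continuous_map X scott_ennreal (f i)"
  shows "continuous_map X scott_ennreal (\<lambda>x. SUP i\<in>I. f i x)"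
  unfolding continuous_map_scott_ennreal_iff
proof (intro allI impI)
  fix r :: real assume r: "0 \<le> r"
  have "openin X (\<Union>i\<in>I. {x \<in> topspace X. ennreal r < f i x})"
    using r by (auto intro!: openin_superlevel f)
  also have "(\<Union>i\<in>I. {x \<in> topspace X. ennreal r < f i x})
      = {x \<in> topspace X. ennreal r < (SUP i\<in>I. f i x)}"
    by (auto simp: less_SUP_iff)
  finally show "openin X {x \<in> topspace X. ennreal r < (SUP i\<in>I. f i x)}" .
qed

lemma continuous_map_scott_ennreal_indicator:
  assumes "openin X U"
  shows "continuous_map X scott_ennreal (indicator U)"
  unfolding continuous_map_scott_ennreal_iff
proof (intro allI impI)
  fix r :: real assume r: "0 \<le> r"
  have "{x \<in> topspace X. ennreal r < indicator U x} = (if r < 1 then U else {})"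
    using r openin_subset[OF assms]
    by (auto simp: indicator_def ennreal_less_one_iff split: if_splits)
  then show "openin X {x \<in> topspace X. ennreal r < indicator U x}"
    using assms by simp
qed

section \<open>Integration with respect to a continuous valuation\<close>

text \<open>For antitone \<open>f\<close> this is the lower Riemann sum over \<open>[0, n]\<close>
  with mesh \<open>1 / 2 ^ n\<close>, taken at right end points. Being a finite positive combination
  of values of \<open>f\<close>, it passes through sums and directed suprema.\<close>

definition dyadic_sum :: "(real \<Rightarrow> ennreal) \<Rightarrow> nat \<Rightarrow> ennreal" where
  "dyadic_sum f n = (\<Sum>k<n * 2 ^ n. f (real (Suc k) / 2 ^ n) * ennreal (1 / 2 ^ n))"

lemma sum_lessThan_double:
  fixes a :: "nat \<Rightarrow> 'a :: comm_monoid_add"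
  shows "(\<Sum>j<2 * M. a j) = (\<Sum>k<M. a (2 * k) + a (Suc (2 * k)))"
  by (induction M) (simp_all add: ac_simps)

text \<open>Refinement halves each cell, and at the right end of either half \<open>f\<close> is at
  least its value at the right end of the cell. The new cells beyond \<open>n\<close> only add to
  the sum.\<close>

lemma incseq_dyadic_sum:
  assumes anti: "\<And>r s. 0 \<le> r \<Longrightarrow> r \<le> s \<Longrightarrow> f s \<le> f r"
  shows "incseq (dyadic_sum f)"
proof (rule incseq_SucI)
  fix n :: nat
  let ?g = "\<lambda>j. f (real (Suc j) / 2 ^ Suc n) * ennreal (1 / 2 ^ Suc n)"
  have half: "ennreal (1 / 2 ^ n) = ennreal (1 / 2 ^ Suc n) + ennreal (1 / 2 ^ Suc n)"
    by (simp flip: ennreal_plus)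
  have "dyadic_sum f n \<le> (\<Sum>k<n * 2 ^ n. ?g (2 * k) + ?g (Suc (2 * k)))"
    unfolding dyadic_sum_def half distrib_left
  proof (intro sum_mono add_mono mult_right_mono anti)
    fix k :: nat
    show "real (Suc (2 * k)) / 2 ^ Suc n \<le> real (Suc k) / 2 ^ n"
      "real (Suc (Suc (2 * k))) / 2 ^ Suc n \<le> real (Suc k) / 2 ^ n"
      by (simp_all add: field_simps)
  qed auto
  also have "\<dots> = (\<Sum>j<2 * (n * 2 ^ n). ?g j)" by (rule sum_lessThan_double[symmetric])
  also have "\<dots> \<le> (\<Sum>j<Suc n * 2 ^ Suc n. ?g j)" by (rule sum_mono2) auto
  finally show "dyadic_sum f n \<le> dyadic_sum f (Suc n)" by (simp add: dyadic_sum_def)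
qed

text \<open>Layer cake for a single number. It yields the pointwise convergence of dyadic step
  functions and the integrals against valuations with values 0 and 1.\<close>

lemma nn_integral_superlevel:
  "(\<integral>\<^sup>+ r\<in>{0..}. (if ennreal r < y then 1 else 0) \<partial>lborel) = y"
proof (cases y)
  case (real u)
  have "(\<integral>\<^sup>+ r\<in>{0..}. (if ennreal r < y then 1 else 0) \<partial>lborel)
      = (\<integral>\<^sup>+ r. indicator {0..<u} r \<partial>lborel)"
    using real by (intro nn_integral_cong) (auto simp: indicator_def ennreal_less_iff)
  then show ?thesis using real by simp
next
  case top
  have "(\<integral>\<^sup>+ r\<in>{0..}. (if ennreal r < y then 1 else 0) \<partial>lborel)
      = (\<integral>\<^sup>+ r. indicator {0::real..} r \<partial>lborel)"
    using top by (intro nn_integral_cong) (auto simp: indicator_def)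
  also have "\<dots> = top"
  proof (rule top.extremum_uniqueI[OF order_trans])
    show "top \<le> (SUP n. of_nat n :: ennreal)" by (simp add: ennreal_SUP_of_nat_eq_top)
    have "of_nat n \<le> emeasure lborel {0::real..}" for n
      using emeasure_mono[of "{0..real n}" "{0..}" lborel] by (simp add: ennreal_of_nat_eq_real_of_nat)
    then show "(SUP n. of_nat n) \<le> (\<integral>\<^sup>+ r. indicator {0::real..} r \<partial>lborel)"
      by (simp add: SUP_le_iff)
  qed
  finally show ?thesis using top by simp
qed

text \<open>The dyadic formula applied to the indicator of \<open>[0, y)\<close>. Continuity from
  the right holds because the strict inequality \<open>ennreal r < y\<close> survives a small
  increase of \<open>r\<close>.\<close>

lemma SUP_dyadic_sum_superlevel:
  "(SUP n. dyadic_sum (\<lambda>r. if ennreal r < y then 1 else 0) n) = y"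
proof -
  have "(\<integral>\<^sup>+ r\<in>{0..}. (if ennreal r < y then 1 else 0) \<partial>lborel)
      = (SUP n. dyadic_sum (\<lambda>r. if ennreal r < y then 1 else 0) n)"
    unfolding dyadic_sum_def
  proof (rule nn_integral_antimono_eq_SUP_dyadic)
    fix r s :: real assume "0 \<le> r" "r \<le> s"
    then show "(if ennreal s < y then 1 else 0) \<le> (if ennreal r < y then 1 else (0 :: ennreal))"
      by (auto dest: ennreal_leI)
  next
    fix r :: real assume r: "0 \<le> r"
    show "(if ennreal r < y then 1 else 0)
        = (SUP s\<in>{r<..}. if ennreal s < y then 1 else (0 :: ennreal))"
    proof (cases "ennreal r < y")
      case True
      then obtain s where s: "0 \<le> s" "ennreal r < ennreal s" "ennreal s < y"
        by (rule ennreal_less_obtain)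
      then have "r < s" using r by (simp add: ennreal_less_iff)
      then have "1 \<le> (SUP s\<in>{r<..}. if ennreal s < y then 1 else (0 :: ennreal))"
        using s by (intro SUP_upper2[of s]) auto
      moreover have "(SUP s\<in>{r<..}. if ennreal s < y then 1 else (0 :: ennreal)) \<le> 1"
        by (intro SUP_least) auto
      ultimately show ?thesis using True by simp
    next
      case False
      have "ennreal s \<ge> y" if "r < s" for s
        using False ennreal_leI[of r s] that by (auto simp: not_less intro: order_trans)
      then have "(SUP s\<in>{r<..}. if ennreal s < y then 1 else (0 :: ennreal)) = (SUP s\<in>{r<..}. 0)"
        by (intro SUP_cong) (auto simp: not_less[symmetric])
      then show ?thesis using False by simp
    qed
  qed
  then show ?thesis by (simp add: nn_integral_superlevel)
qed

lemma valuation_empty: "\<mu> \<in> continuous_valuations X \<Longrightarrow> \<mu> {} = 0"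
  by (simp add: continuous_valuations_def)

lemma valuation_mono:
  "\<mu> \<in> continuous_valuations X \<Longrightarrow> openin X U \<Longrightarrow> openin X V \<Longrightarrow> U \<subseteq> V \<Longrightarrow> \<mu> U \<le> \<mu> V"
  by (simp add: continuous_valuations_def)

lemma valuation_modular:
  "\<mu> \<in> continuous_valuations X \<Longrightarrow> openin X U \<Longrightarrow> openin X V \<Longrightarrow>
     \<mu> U + \<mu> V = \<mu> (U \<union> V) + \<mu> (U \<inter> V)"
  by (simp add: continuous_valuations_def)

lemma valuation_UN_directed:
  assumes \<mu>: "\<mu> \<in> continuous_valuations X" and "I \<noteq> {}"
    and "\<And>i. i \<in> I \<Longrightarrow> openin X (U i)"
    and dir: "\<And>i j. i \<in> I \<Longrightarrow> j \<in> I \<Longrightarrow> \<exists>k\<in>I. U i \<subseteq> U k \<and> U j \<subseteq> U k"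
  shows "\<mu> (\<Union>i\<in>I. U i) = (SUP i\<in>I. \<mu> (U i))"
proof -
  have "directed_family (U ` I)"
    using assms(2) dir by (auto simp: directed_family_def)
  moreover have "\<forall>V\<in>U ` I. openin X V" using assms(3) by auto
  ultimately have "\<mu> (\<Union>(U ` I)) = (SUP V\<in>U ` I. \<mu> V)"
    using \<mu> by (simp add: continuous_valuations_def)
  then show ?thesis by (simp add: image_comp comp_def)
qed

section \<open>Multiplicity layers of a finite family of open sets, and step functions\<close>

lemma sum_indicator_eq_of_nat_card:
  "finite I \<Longrightarrow> (\<Sum>i\<in>I. indicator (U i) x) = (of_nat (card {i\<in>I. x \<in> U i}) :: ennreal)"
  by (simp add: indicator_def sum.If_cases Int_def)

text \<open>The multiplicity is a sum of indicators of open sets, hence lower semi-continuous, and a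
  layer is one of its superlevel sets.\<close>

lemma openin_layer:
  assumes "finite I" "\<And>i. i \<in> I \<Longrightarrow> openin X (U i)"
  shows "openin X {x \<in> topspace X. k < card {i\<in>I. x \<in> U i}}"
proof -
  have "continuous_map X scott_ennreal (\<lambda>x. \<Sum>i\<in>I. indicator (U i) x)"
    using assms by (intro continuous_map_scott_ennreal_sum continuous_map_scott_ennreal_indicator)
  from openin_superlevel[OF this, of "real k"] show ?thesis
    using assms(1) by (simp add: sum_indicator_eq_of_nat_card ennreal_of_nat_eq_real_of_nat ennreal_less_iff)
qed

text \<open>Adding one open set \<open>U j\<close> to the family pushes it through the layers: at layer \<open>k\<close> the
  remainder \<open>R k\<close> is joined to the layer and, by modularity, their intersection is carried on
  to layer \<open>k + 1\<close>. No subtraction occurs, so infinite values do no harm.\<close>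

lemma valuation_sum_eq_sum_layers:
  assumes \<mu>: "\<mu> \<in> continuous_valuations X"
    and "finite I" "\<And>i. i \<in> I \<Longrightarrow> openin X (U i)"
  shows "(\<Sum>i\<in>I. \<mu> (U i)) = (\<Sum>k<card I. \<mu> {x \<in> topspace X. k < card {i\<in>I. x \<in> U i}})"
  using assms(2,3)
proof (induction I rule: finite_induct)
  case (insert j I)
  define W where "W k = {x \<in> topspace X. k < card {i\<in>I. x \<in> U i}}" for k
  define W' where "W' k = {x \<in> topspace X. k < card {i\<in>insert j I. x \<in> U i}}" for k
  define R where "R k = (case k of 0 \<Rightarrow> U j | Suc l \<Rightarrow> W l \<inter> U j)" for k
  have Uj: "openin X (U j)" "U j \<subseteq> topspace X"
    using insert.prems by (auto dest: openin_subset)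
  have W_open: "openin X (W k)" for k
    unfolding W_def using insert by (intro openin_layer) auto
  have R_open: "openin X (R k)" for k
    unfolding R_def using Uj W_open by (auto split: nat.split)
  have card': "card {i\<in>insert j I. x \<in> U i} = card {i\<in>I. x \<in> U i} + (if x \<in> U j then 1 else 0)" for x
  proof -
    have "{i\<in>insert j I. x \<in> U i} = (if x \<in> U j then insert j {i\<in>I. x \<in> U i} else {i\<in>I. x \<in> U i})"
      by auto
    then show ?thesis using insert.hyps by simp
  qed
  have W': "W' k = R k \<union> W k" for k
    unfolding W'_def card' using Uj by (cases k) (auto simp: W_def R_def split: if_splits)
  have R_Suc: "R k \<inter> W k = R (Suc k)" for k
    by (cases k) (auto simp: R_def W_def)
  have step: "\<mu> (R k) + \<mu> (W k) = \<mu> (W' k) + \<mu> (R (Suc k))" for k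
    using valuation_modular[OF \<mu> R_open W_open, of k k] by (simp add: W' R_Suc)
  have tele: "\<mu> (U j) + (\<Sum>k<m. \<mu> (W k)) = (\<Sum>k<m. \<mu> (W' k)) + \<mu> (R m)" for m
  proof (induction m)
    case (Suc m)
    have "\<mu> (U j) + (\<Sum>k<Suc m. \<mu> (W k)) = (\<Sum>k<m. \<mu> (W' k)) + (\<mu> (R m) + \<mu> (W m))"
      using Suc by (simp add: ac_simps flip: add.assoc)
    then show ?case by (simp add: step ac_simps)
  qed (simp add: R_def)
  \<comment> \<open>Multiplicities in \<open>I\<close> never exceed \<open>card I\<close>, so the
    layer with index \<open>card I\<close> is empty. The old sum may thus be prolonged by one term,
    and the last remainder \<open>R (Suc (card I))\<close> vanishes.\<close>
  have "card {i\<in>I. x \<in> U i} \<le> card I" for x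
    using insert.hyps by (intro card_mono) auto
  then have W_top: "W (card I) = {}"
    by (auto simp: W_def not_less)
  have "(\<Sum>i\<in>insert j I. \<mu> (U i)) = \<mu> (U j) + (\<Sum>k<Suc (card I). \<mu> (W k))"
    using insert by (simp add: W_def[symmetric] W_top valuation_empty[OF \<mu>])
  also have "\<dots> = (\<Sum>k<Suc (card I). \<mu> (W' k))"
    unfolding tele by (simp add: R_def W_top valuation_empty[OF \<mu>])
  finally show ?case using insert.hyps by (simp add: W'_def)
qed simp

lemma valuation_integral_cong:
  "(\<And>x. x \<in> topspace X \<Longrightarrow> g x = h x) \<Longrightarrow> valuation_integral X \<mu> g = valuation_integral X \<mu> h"
  by (simp add: valuation_integral_def cong: conj_cong)

text \<open>On the cell \<open>[c * k, c * (k + 1))\<close> the integrand is constantly the value of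
  \<open>\<mu>\<close> at layer \<open>k\<close>. So the integral is \<open>c\<close> times the sum
  over the layers, which is the sum over the family.\<close>

lemma valuation_integral_step:
  assumes \<mu>: "\<mu> \<in> continuous_valuations X"
    and I: "finite I" "\<And>i. i \<in> I \<Longrightarrow> openin X (U i)" and c: "0 < c"
  shows "valuation_integral X \<mu> (\<lambda>x. ennreal c * (\<Sum>i\<in>I. indicator (U i) x))
    = ennreal c * (\<Sum>i\<in>I. \<mu> (U i))"
proof -
  define W where "W k = {x \<in> topspace X. k < card {i\<in>I. x \<in> U i}}" for k
  define J where "J k = {c * real k..<c * real (Suc k)}" for k
  have eq: "\<mu> {x \<in> topspace X. ennreal r < ennreal c * (\<Sum>i\<in>I. indicator (U i) x)} * indicator {0..} r
      = (\<Sum>k<card I. \<mu> (W k) * indicator (J k) r)" for r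
  proof (cases "0 \<le> r")
    case True
    \<comment> \<open>The index of the cell of length \<open>c\<close> that contains
      \<open>r\<close>: a point of multiplicity \<open>m\<close> satisfies \<open>r < c * m\<close>
      exactly when \<open>m > K\<close>, so the superlevel set at \<open>r\<close> is the layer
      \<open>K\<close>.\<close>
    define K where "K = nat \<lfloor>r / c\<rfloor>"
    have K_less: "K < m \<longleftrightarrow> r < c * real m" for m
    proof -
      have "K < m \<longleftrightarrow> r / c < real m"
        using True c by (auto simp: K_def nat_less_iff floor_less_iff)
      then show ?thesis using c by (simp add: field_simps)
    qed
    have J_iff: "r \<in> J k \<longleftrightarrow> k = K" for k
    proof -
      have "r \<in> J k \<longleftrightarrow> \<not> K < k \<and> K < Suc k"
        unfolding K_less J_def by (simp add: not_less del: of_nat_Suc)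
      then show ?thesis by auto
    qed
    have "ennreal r < ennreal c * of_nat m \<longleftrightarrow> K < m" for m
      using True c unfolding K_less
      by (simp add: ennreal_of_nat_eq_real_of_nat ennreal_less_iff flip: ennreal_mult')
    then have "{x \<in> topspace X. ennreal r < ennreal c * (\<Sum>i\<in>I. indicator (U i) x)} = W K"
      unfolding W_def sum_indicator_eq_of_nat_card[OF I(1)] by simp
    moreover have "\<mu> (W K) = (\<Sum>k<card I. if k = K then \<mu> (W k) else 0)"
    proof (cases "K < card I")
      case False
      have "card {i\<in>I. x \<in> U i} \<le> card I" for x
        using I by (intro card_mono) auto
      then have "\<not> K < card {i\<in>I. x \<in> U i}" for x
        using False by (meson le_trans not_less)
      then have "W K = {}" by (simp add: W_def)
      then show ?thesis using False by (simp add: valuation_empty[OF \<mu>])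
    qed simp
    moreover have "(\<Sum>k<card I. if k = K then \<mu> (W k) else 0) = (\<Sum>k<card I. \<mu> (W k) * indicator (J k) r)"
      by (intro sum.cong) (auto simp: J_iff indicator_def)
    ultimately show ?thesis using True by simp
  next
    case False
    have "r \<notin> J k" for k
    proof -
      have "0 \<le> c * real k" using c by simp
      then show ?thesis using False unfolding J_def by (simp del: of_nat_Suc)
    qed
    then show ?thesis using False by simp
  qed
  have J: "J k \<in> sets lborel" "emeasure lborel (J k) = ennreal c" for k
    using c by (simp_all add: J_def algebra_simps)
  have "valuation_integral X \<mu> (\<lambda>x. ennreal c * (\<Sum>i\<in>I. indicator (U i) x))
      = (\<integral>\<^sup>+ r. (\<Sum>k<card I. \<mu> (W k) * indicator (J k) r) \<partial>lborel)"
    unfolding valuation_integral_def eq ..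
  also have "\<dots> = (\<Sum>k<card I. \<integral>\<^sup>+ r. \<mu> (W k) * indicator (J k) r \<partial>lborel)"
    by (rule nn_integral_sum)
       (intro borel_measurable_times_ennreal borel_measurable_indicator J borel_measurable_const)
  also have "\<dots> = (\<Sum>k<card I. \<mu> (W k)) * ennreal c"
    by (simp only: nn_integral_cmult_indicator[OF J(1)] J(2) sum_distrib_right)
  also have "(\<Sum>k<card I. \<mu> (W k)) = (\<Sum>i\<in>I. \<mu> (U i))"
    unfolding W_def by (rule valuation_sum_eq_sum_layers[OF \<mu> I, symmetric])
  finally show ?thesis by (simp add: mult.commute)
qed

lemma valuation_integral_dyadic:
  assumes "\<mu> \<in> continuous_valuations X" "continuous_map X scott_ennreal h"
  shows "valuation_integral X \<mu> h = (SUP n. dyadic_sum (\<lambda>r. \<mu> {x \<in> topspace X. ennreal r < h x}) n)"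
  unfolding dyadic_sum_def by (rule valuation_integral_eq_SUP_dyadic[OF assms])

text \<open>The dominating index \<open>k\<close> has to serve all summands at once; this lets the
  induction split off one summand and apply the two-term law for directed suprema.\<close>

lemma SUP_sum_directed_ennreal:
  fixes f :: "'a \<Rightarrow> 'b \<Rightarrow> ennreal"
  assumes "I \<noteq> {}"
    and dir: "\<And>i j. i \<in> I \<Longrightarrow> j \<in> I \<Longrightarrow> \<exists>k\<in>I. \<forall>a\<in>A. f a i \<le> f a k \<and> f a j \<le> f a k"
  shows "(SUP i\<in>I. \<Sum>a\<in>A. f a i) = (\<Sum>a\<in>A. SUP i\<in>I. f a i)"
  using dir
proof (induction A rule: infinite_finite_induct)
  case (insert b A)
  have "(SUP i\<in>I. f b i + (\<Sum>a\<in>A. f a i)) = (SUP i\<in>I. f b i) + (SUP i\<in>I. \<Sum>a\<in>A. f a i)"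
  proof (rule SUP_add_directed_ennreal)
    fix i j assume "i \<in> I" "j \<in> I"
    with insert.prems obtain k where "k \<in> I" "\<forall>a\<in>insert b A. f a i \<le> f a k \<and> f a j \<le> f a k"
      by blast
    then show "\<exists>k\<in>I. f b i + (\<Sum>a\<in>A. f a j) \<le> f b k + (\<Sum>a\<in>A. f a k)"
      by (intro bexI[of _ k]) (auto intro!: add_mono sum_mono)
  qed
  moreover have "(SUP i\<in>I. \<Sum>a\<in>A. f a i) = (\<Sum>a\<in>A. SUP i\<in>I. f a i)"
    using insert.prems by (intro insert.IH) blast
  ultimately show ?case using insert.hyps by simp
qed (use \<open>I \<noteq> {}\<close> in auto)

text \<open>A superlevel set of the supremum is the directed union of the superlevel sets, so
  continuity of \<open>\<mu>\<close> takes the supremum out at each level. It then passes the finite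
  dyadic sums and commutes with the supremum over \<open>n\<close>.\<close>

lemma valuation_integral_SUP_directed:
  assumes \<mu>: "\<mu> \<in> continuous_valuations X" and "I \<noteq> {}"
    and h: "\<And>i. i \<in> I \<Longrightarrow> continuous_map X scott_ennreal (h i)"
    and dir: "\<And>i j. i \<in> I \<Longrightarrow> j \<in> I \<Longrightarrow> \<exists>k\<in>I. \<forall>x\<in>topspace X. h i x \<le> h k x \<and> h j x \<le> h k x"
  shows "valuation_integral X \<mu> (\<lambda>x. SUP i\<in>I. h i x) = (SUP i\<in>I. valuation_integral X \<mu> (h i))"
proof -
  define U where "U i r = {x \<in> topspace X. ennreal r < h i x}" for i r
  have U: "openin X (U i r)" if "i \<in> I" "0 \<le> r" for i r
    unfolding U_def by (rule openin_superlevel[OF h[OF that(1)] that(2)])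
  have dirU: "\<exists>k\<in>I. \<forall>r. U i r \<subseteq> U k r \<and> U j r \<subseteq> U k r" if ij: "i \<in> I" "j \<in> I" for i j
  proof -
    obtain k where "k \<in> I" "\<forall>x\<in>topspace X. h i x \<le> h k x \<and> h j x \<le> h k x"
      using dir[OF ij] by blast
    then show ?thesis by (intro bexI[of _ k]) (auto simp: U_def intro: less_le_trans)
  qed
  have level: "\<mu> {x \<in> topspace X. ennreal r < (SUP i\<in>I. h i x)} = (SUP i\<in>I. \<mu> (U i r))" if r: "0 \<le> r" for r
  proof -
    have "{x \<in> topspace X. ennreal r < (SUP i\<in>I. h i x)} = (\<Union>i\<in>I. U i r)"
      by (auto simp: U_def less_SUP_iff)
    then show ?thesis
      using valuation_UN_directed[OF \<mu> \<open>I \<noteq> {}\<close>, of "\<lambda>i. U i r"] U[OF _ r] dirU by metis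
  qed
  have "dyadic_sum (\<lambda>r. \<mu> {x \<in> topspace X. ennreal r < (SUP i\<in>I. h i x)}) n
      = (SUP i\<in>I. dyadic_sum (\<lambda>r. \<mu> (U i r)) n)" for n
  proof -
    have "(SUP i\<in>I. dyadic_sum (\<lambda>r. \<mu> (U i r)) n)
      = (\<Sum>k<n * 2 ^ n. SUP i\<in>I. \<mu> (U i (real (Suc k) / 2 ^ n)) * ennreal (1 / 2 ^ n))"
      unfolding dyadic_sum_def
    proof (rule SUP_sum_directed_ennreal[OF \<open>I \<noteq> {}\<close>])
      fix i j assume ij: "i \<in> I" "j \<in> I"
      then obtain k where k: "k \<in> I" "\<forall>r. U i r \<subseteq> U k r \<and> U j r \<subseteq> U k r"
        using dirU by blast
      have "\<mu> (U i r) \<le> \<mu> (U k r) \<and> \<mu> (U j r) \<le> \<mu> (U k r)" if "0 \<le> r" for r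
        using k ij that by (auto intro!: valuation_mono[OF \<mu>] U)
      then show "\<exists>k\<in>I. \<forall>a\<in>{..<n * 2 ^ n}.
          \<mu> (U i (real (Suc a) / 2 ^ n)) * ennreal (1 / 2 ^ n) \<le> \<mu> (U k (real (Suc a) / 2 ^ n)) * ennreal (1 / 2 ^ n) \<and>
          \<mu> (U j (real (Suc a) / 2 ^ n)) * ennreal (1 / 2 ^ n) \<le> \<mu> (U k (real (Suc a) / 2 ^ n)) * ennreal (1 / 2 ^ n)"
        using k by (intro bexI[of _ k]) (auto intro!: mult_right_mono)
    qed
    then show ?thesis by (simp add: dyadic_sum_def level SUP_mult_right_ennreal)
  qed
  then have "valuation_integral X \<mu> (\<lambda>x. SUP i\<in>I. h i x)
      = (SUP n. SUP i\<in>I. dyadic_sum (\<lambda>r. \<mu> (U i r)) n)"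
    using h by (subst valuation_integral_dyadic[OF \<mu>]) (auto intro!: continuous_map_scott_ennreal_SUP)
  also have "\<dots> = (SUP i\<in>I. SUP n. dyadic_sum (\<lambda>r. \<mu> (U i r)) n)" by (rule SUP_commute)
  also have "\<dots> = (SUP i\<in>I. valuation_integral X \<mu> (h i))"
    unfolding U_def using h by (intro SUP_cong) (simp_all add: valuation_integral_dyadic[OF \<mu>])
  finally show ?thesis .
qed

lemma valuation_integral_SUP_incseq:
  fixes h :: "nat \<Rightarrow> 'a \<Rightarrow> ennreal"
  assumes \<mu>: "\<mu> \<in> continuous_valuations X"
    and h: "\<And>n. continuous_map X scott_ennreal (h n)"
    and inc: "\<And>x. x \<in> topspace X \<Longrightarrow> incseq (\<lambda>n. h n x)"
  shows "valuation_integral X \<mu> (\<lambda>x. SUP n. h n x) = (SUP n. valuation_integral X \<mu> (h n))"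
proof (rule valuation_integral_SUP_directed[OF \<mu> _ h])
  fix i j
  show "\<exists>k\<in>UNIV. \<forall>x\<in>topspace X. h i x \<le> h k x \<and> h j x \<le> h k x"
    using inc by (intro bexI[of _ "max i j"]) (auto simp: incseq_def)
qed simp

section \<open>Dyadic step functions and linearity of the integral\<close>

definition dyadic_level :: "'a topology \<Rightarrow> ('a \<Rightarrow> ennreal) \<Rightarrow> nat \<Rightarrow> nat \<Rightarrow> 'a set" where
  "dyadic_level X h n k = {x \<in> topspace X. ennreal (real (Suc k) / 2 ^ n) < h x}"

text \<open>Where \<open>h x > 0\<close>, this is the largest multiple of \<open>1 / 2 ^ n\<close>
  strictly below \<open>h x\<close>, cut off at \<open>n\<close>; where \<open>h x = 0\<close> it is
  \<open>0\<close>.\<close>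

definition dyadic_approx :: "'a topology \<Rightarrow> ('a \<Rightarrow> ennreal) \<Rightarrow> nat \<Rightarrow> 'a \<Rightarrow> ennreal" where
  "dyadic_approx X h n x = ennreal (1 / 2 ^ n) * (\<Sum>k<n * 2 ^ n. indicator (dyadic_level X h n k) x)"

lemma openin_dyadic_level:
  "continuous_map X scott_ennreal h \<Longrightarrow> openin X (dyadic_level X h n k)"
  unfolding dyadic_level_def by (rule openin_superlevel) auto

lemma continuous_map_dyadic_approx:
  "continuous_map X scott_ennreal h \<Longrightarrow> continuous_map X scott_ennreal (dyadic_approx X h n)"
  unfolding dyadic_approx_def[abs_def]
  by (intro continuous_map_scott_ennreal_cmult continuous_map_scott_ennreal_sum
      continuous_map_scott_ennreal_indicator openin_dyadic_level)

lemma dyadic_approx_eq_dyadic_sum: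
  "x \<in> topspace X \<Longrightarrow> dyadic_approx X h n x = dyadic_sum (\<lambda>r. if ennreal r < h x then 1 else 0) n"
  unfolding dyadic_approx_def dyadic_sum_def dyadic_level_def sum_distrib_left
  by (intro sum.cong) (auto simp: indicator_def)

lemma incseq_dyadic_approx: "x \<in> topspace X \<Longrightarrow> incseq (\<lambda>n. dyadic_approx X h n x)"
  unfolding dyadic_approx_eq_dyadic_sum
  by (rule incseq_dyadic_sum) (auto dest: ennreal_leI)

lemma SUP_dyadic_approx: "x \<in> topspace X \<Longrightarrow> (SUP n. dyadic_approx X h n x) = h x"
  by (simp add: dyadic_approx_eq_dyadic_sum SUP_dyadic_sum_superlevel)

lemma dyadic_sum_eq_sum_level:
  "dyadic_sum (\<lambda>r. \<mu> {x \<in> topspace X. ennreal r < h x}) n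
    = ennreal (1 / 2 ^ n) * (\<Sum>k<n * 2 ^ n. \<mu> (dyadic_level X h n k))"
  by (simp add: dyadic_sum_def dyadic_level_def sum_distrib_left mult.commute)

text \<open>The factor is absorbed into the mesh of the step functions, whose integrals are known
  for every positive mesh; monotone suprema carry the law over to \<open>h\<close>.\<close>

lemma valuation_integral_cmult:
  assumes \<mu>: "\<mu> \<in> continuous_valuations X" and h: "continuous_map X scott_ennreal h" and c: "0 < c"
  shows "valuation_integral X \<mu> (\<lambda>x. ennreal c * h x) = ennreal c * valuation_integral X \<mu> h"
proof -
  have "valuation_integral X \<mu> (\<lambda>x. ennreal c * h x)
      = valuation_integral X \<mu> (\<lambda>x. SUP n. ennreal c * dyadic_approx X h n x)"
    by (intro valuation_integral_cong) (simp add: SUP_dyadic_approx flip: SUP_mult_left_ennreal)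
  also have "\<dots> = (SUP n. valuation_integral X \<mu> (\<lambda>x. ennreal c * dyadic_approx X h n x))"
    using incseq_dyadic_approx
    by (intro valuation_integral_SUP_incseq \<mu> continuous_map_scott_ennreal_cmult continuous_map_dyadic_approx h)
      (fastforce simp: incseq_def intro!: mult_left_mono)
  also have "\<dots> = (SUP n. ennreal c * dyadic_sum (\<lambda>r. \<mu> {x \<in> topspace X. ennreal r < h x}) n)"
  proof (rule SUP_cong[OF refl])
    fix n
    have "valuation_integral X \<mu> (\<lambda>x. ennreal c * dyadic_approx X h n x)
        = valuation_integral X \<mu>
            (\<lambda>x. ennreal (c * (1 / 2 ^ n)) * (\<Sum>k<n * 2 ^ n. indicator (dyadic_level X h n k) x))"
      using c by (simp add: dyadic_approx_def ennreal_mult' mult.assoc del: times_divide_eq_right)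
    also have "\<dots> = ennreal (c * (1 / 2 ^ n)) * (\<Sum>k<n * 2 ^ n. \<mu> (dyadic_level X h n k))"
      using c by (intro valuation_integral_step \<mu> openin_dyadic_level h) auto
    finally show "valuation_integral X \<mu> (\<lambda>x. ennreal c * dyadic_approx X h n x)
        = ennreal c * dyadic_sum (\<lambda>r. \<mu> {x \<in> topspace X. ennreal r < h x}) n"
      using c by (simp add: dyadic_sum_eq_sum_level ennreal_mult' mult.assoc del: times_divide_eq_right)
  qed
  also have "\<dots> = ennreal c * valuation_integral X \<mu> h"
    by (simp add: valuation_integral_dyadic[OF \<mu> h] SUP_mult_left_ennreal)
  finally show ?thesis .
qed

text \<open>The approximations of \<open>g\<close> and \<open>h\<close> at the same \<open>n\<close>
  have the same mesh, so their sum is again a step function and its integral is the sum of the two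
  dyadic sums.\<close>

lemma valuation_integral_add:
  assumes \<mu>: "\<mu> \<in> continuous_valuations X"
    and g: "continuous_map X scott_ennreal g" and h: "continuous_map X scott_ennreal h"
  shows "valuation_integral X \<mu> (\<lambda>x. g x + h x) = valuation_integral X \<mu> g + valuation_integral X \<mu> h"
proof -
  have anti: "\<mu> {x \<in> topspace X. ennreal s < f x} \<le> \<mu> {x \<in> topspace X. ennreal r < f x}"
    if "continuous_map X scott_ennreal f" "0 \<le> r" "r \<le> s" for f r s
    using that
    by (intro valuation_mono[OF \<mu>] openin_superlevel)
      (auto intro: le_less_trans[OF ennreal_leI])
  have "valuation_integral X \<mu> (\<lambda>x. g x + h x)
      = valuation_integral X \<mu> (\<lambda>x. SUP n. dyadic_approx X g n x + dyadic_approx X h n x)"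
    by (intro valuation_integral_cong)
      (simp add: SUP_dyadic_approx ennreal_SUP_add[OF incseq_dyadic_approx incseq_dyadic_approx])
  also have "\<dots> = (SUP n. valuation_integral X \<mu> (\<lambda>x. dyadic_approx X g n x + dyadic_approx X h n x))"
    using incseq_dyadic_approx
    by (intro valuation_integral_SUP_incseq \<mu> continuous_map_scott_ennreal_add continuous_map_dyadic_approx g h)
      (fastforce simp: incseq_def intro!: add_mono)
  also have "\<dots> = (SUP n. dyadic_sum (\<lambda>r. \<mu> {x \<in> topspace X. ennreal r < g x}) n
                      + dyadic_sum (\<lambda>r. \<mu> {x \<in> topspace X. ennreal r < h x}) n)"
  proof (rule SUP_cong[OF refl])
    fix n
    define N where "N = {..<n * 2 ^ n :: nat}"
    \<comment> \<open>A disjoint sum of index sets: an open set that is a level of both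
      \<open>g\<close> and \<open>h\<close> has to be counted twice.\<close>
    define U where "U = case_sum (dyadic_level X g n) (dyadic_level X h n)"
    have "valuation_integral X \<mu> (\<lambda>x. dyadic_approx X g n x + dyadic_approx X h n x)
        = valuation_integral X \<mu> (\<lambda>x. ennreal (1 / 2 ^ n) * (\<Sum>i\<in>N <+> N. indicator (U i) x))"
      by (simp add: dyadic_approx_def N_def U_def sum.Plus distrib_left)
    also have "\<dots> = ennreal (1 / 2 ^ n) * (\<Sum>i\<in>N <+> N. \<mu> (U i))"
      by (intro valuation_integral_step \<mu>) (auto simp: N_def U_def intro!: openin_dyadic_level g h)
    finally show "valuation_integral X \<mu> (\<lambda>x. dyadic_approx X g n x + dyadic_approx X h n x)
        = dyadic_sum (\<lambda>r. \<mu> {x \<in> topspace X. ennreal r < g x}) n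
        + dyadic_sum (\<lambda>r. \<mu> {x \<in> topspace X. ennreal r < h x}) n"
      by (simp add: dyadic_sum_eq_sum_level N_def U_def sum.Plus distrib_left)
  qed
  also have "\<dots> = valuation_integral X \<mu> g + valuation_integral X \<mu> h"
    unfolding valuation_integral_dyadic[OF \<mu> g] valuation_integral_dyadic[OF \<mu> h]
    by (intro ennreal_SUP_add incseq_dyadic_sum anti g h)
  finally show ?thesis .
qed

lemma valuation_integral_zero:
  "\<mu> \<in> continuous_valuations X \<Longrightarrow> valuation_integral X \<mu> (\<lambda>x. 0) = 0"
  by (simp add: valuation_integral_def valuation_empty)

lemma valuation_integral_sum:
  assumes \<mu>: "\<mu> \<in> continuous_valuations X"
    and "\<And>i. i \<in> I \<Longrightarrow> continuous_map X scott_ennreal (h i)"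
  shows "valuation_integral X \<mu> (\<lambda>x. \<Sum>i\<in>I. h i x) = (\<Sum>i\<in>I. valuation_integral X \<mu> (h i))"
  using assms(2)
  by (induction I rule: infinite_finite_induct)
    (simp_all add: valuation_integral_zero[OF \<mu>] valuation_integral_add[OF \<mu>] continuous_map_scott_ennreal_sum)

lemma valuation_integral_mono:
  assumes \<mu>: "\<mu> \<in> continuous_valuations X"
    and g: "continuous_map X scott_ennreal g" and h: "continuous_map X scott_ennreal h"
    and le: "\<And>x. x \<in> topspace X \<Longrightarrow> g x \<le> h x"
  shows "valuation_integral X \<mu> g \<le> valuation_integral X \<mu> h"
  unfolding valuation_integral_def
proof (rule nn_integral_mono)
  fix r :: real
  have "\<mu> {x \<in> topspace X. ennreal r < g x} \<le> \<mu> {x \<in> topspace X. ennreal r < h x}" if "0 \<le> r"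
    using le that by (intro valuation_mono[OF \<mu>] openin_superlevel g h) (auto intro: less_le_trans)
  then show "\<mu> {x \<in> topspace X. ennreal r < g x} * indicator {0..} r
      \<le> \<mu> {x \<in> topspace X. ennreal r < h x} * indicator {0..} r"
    by (auto simp: indicator_def)
qed

section \<open>The monad structure\<close>

lemma continuous_map_valuation_eval:
  assumes U: "openin X U"
  shows "continuous_map (Vw X) scott_ennreal (\<lambda>\<mu>. \<mu> U)"
  unfolding continuous_map_scott_ennreal_iff topspace_Vw
proof (intro allI impI)
  fix r :: real assume "0 \<le> r"
  with U show "openin (Vw X) {\<mu> \<in> continuous_valuations X. ennreal r < \<mu> U}"
    unfolding Vw_def by (intro topology_generated_by_Basis) blast
qed

text \<open>The dyadic formula presents the integral as a supremum of positive combinations of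
  evaluations \<open>\<mu> U\<close>, and the weak topology makes these lower
  semi-continuous.\<close>

lemma continuous_map_valuation_integral:
  assumes h: "continuous_map X scott_ennreal h"
  shows "continuous_map (Vw X) scott_ennreal (\<lambda>\<mu>. valuation_integral X \<mu> h)"
proof (rule continuous_map_eq)
  show "continuous_map (Vw X) scott_ennreal
      (\<lambda>\<mu>. SUP n. ennreal (1 / 2 ^ n) * (\<Sum>k<n * 2 ^ n. \<mu> (dyadic_level X h n k)))"
    by (intro continuous_map_scott_ennreal_SUP continuous_map_scott_ennreal_cmult
        continuous_map_scott_ennreal_sum continuous_map_valuation_eval openin_dyadic_level h)
  show "(SUP n. ennreal (1 / 2 ^ n) * (\<Sum>k<n * 2 ^ n. \<mu> (dyadic_level X h n k)))
      = valuation_integral X \<mu> h" if "\<mu> \<in> topspace (Vw X)" for \<mu>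
    using that by (simp only: valuation_integral_dyadic[OF _ h] dyadic_sum_eq_sum_level topspace_Vw)
qed

lemma directed_familyE:
  assumes "directed_family D" "U \<in> D" "V \<in> D"
  obtains W where "W \<in> D" "U \<subseteq> W" "V \<subseteq> W"
  using assms unfolding directed_family_def by meson

text \<open>Valuations are encoded as extensional functions; this allows the laws to be checked on
  an unrestricted formula \<open>m\<close>.\<close>

lemma restrict_continuous_valuationI:
  assumes "m {} = 0"
    and "\<And>U V. openin X U \<Longrightarrow> openin X V \<Longrightarrow> U \<subseteq> V \<Longrightarrow> m U \<le> m V"
    and "\<And>U V. openin X U \<Longrightarrow> openin X V \<Longrightarrow> m U + m V = m (U \<union> V) + m (U \<inter> V)"
    and cont: "\<And>D. directed_family D \<Longrightarrow> \<forall>U\<in>D. openin X U \<Longrightarrow> m (\<Union>D) = (SUP U\<in>D. m U)"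
  shows "(\<lambda>U\<in>{U. openin X U}. m U) \<in> continuous_valuations X"
proof -
  let ?m = "\<lambda>U\<in>{U. openin X U}. m U"
  have eq: "?m U = m U" if "openin X U" for U using that by simp
  have "?m (\<Union>D) = (SUP U\<in>D. ?m U)" if D: "directed_family D" "\<forall>U\<in>D. openin X U" for D
  proof -
    have "?m (\<Union>D) = (SUP U\<in>D. m U)" using D cont[OF D] by (subst eq) (auto intro: openin_Union)
    also have "\<dots> = (SUP U\<in>D. ?m U)" using D by (intro SUP_cong) (auto simp: eq)
    finally show ?thesis .
  qed
  moreover have "?m U \<le> ?m V" if "openin X U" "openin X V" "U \<subseteq> V" for U V
    using assms(2)[OF that] that by simp
  moreover have "?m U + ?m V = ?m (U \<union> V) + ?m (U \<inter> V)" if "openin X U" "openin X V" for U V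
    using assms(3)[OF that] that by (simp add: openin_Un openin_Int)
  moreover have "?m {} = 0" using assms(1) by simp
  ultimately show ?thesis unfolding continuous_valuations_def by blast
qed

text \<open>Each law is the same law for all \<open>\<mu>\<close>, integrated against
  \<open>\<omega>\<close>: modularity by additivity of the integral, continuity by its directed
  suprema. The evaluations at the members of \<open>D\<close> are directed since every
  \<open>\<mu>\<close> is monotone.\<close>

lemma Vw_mult_continuous_valuation:
  assumes \<omega>: "\<omega> \<in> continuous_valuations (Vw X)"
  shows "Vw_mult X \<omega> \<in> continuous_valuations X"
proof -
  note ev = continuous_map_valuation_eval
  have "valuation_integral (Vw X) \<omega> (\<lambda>\<mu>. \<mu> {}) = 0"
    using valuation_integral_cong[of "Vw X" "\<lambda>\<mu>. \<mu> {}" "\<lambda>\<mu>. 0" \<omega>]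
    by (simp add: valuation_empty valuation_integral_zero[OF \<omega>])
  moreover have "valuation_integral (Vw X) \<omega> (\<lambda>\<mu>. \<mu> U) \<le> valuation_integral (Vw X) \<omega> (\<lambda>\<mu>. \<mu> V)"
    if "openin X U" "openin X V" "U \<subseteq> V" for U V
    using that by (intro valuation_integral_mono \<omega> ev) (auto intro: valuation_mono)
  moreover have "valuation_integral (Vw X) \<omega> (\<lambda>\<mu>. \<mu> U) + valuation_integral (Vw X) \<omega> (\<lambda>\<mu>. \<mu> V)
      = valuation_integral (Vw X) \<omega> (\<lambda>\<mu>. \<mu> (U \<union> V)) + valuation_integral (Vw X) \<omega> (\<lambda>\<mu>. \<mu> (U \<inter> V))"
    if "openin X U" "openin X V" for U V
  proof -
    have "valuation_integral (Vw X) \<omega> (\<lambda>\<mu>. \<mu> U + \<mu> V)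
        = valuation_integral (Vw X) \<omega> (\<lambda>\<mu>. \<mu> (U \<union> V) + \<mu> (U \<inter> V))"
      by (rule valuation_integral_cong) (simp add: valuation_modular[OF _ that])
    then show ?thesis
      by (simp add: that valuation_integral_add[OF \<omega> ev ev] openin_Un openin_Int)
  qed
  moreover have "valuation_integral (Vw X) \<omega> (\<lambda>\<mu>. \<mu> (\<Union>D)) = (SUP U\<in>D. valuation_integral (Vw X) \<omega> (\<lambda>\<mu>. \<mu> U))"
    if D: "directed_family D" "\<forall>U\<in>D. openin X U" for D
  proof -
    have "valuation_integral (Vw X) \<omega> (\<lambda>\<mu>. \<mu> (\<Union>D)) = valuation_integral (Vw X) \<omega> (\<lambda>\<mu>. SUP U\<in>D. \<mu> U)"
      using D by (intro valuation_integral_cong) (simp add: continuous_valuations_def)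
    also have "\<dots> = (SUP U\<in>D. valuation_integral (Vw X) \<omega> (\<lambda>\<mu>. \<mu> U))"
    proof (rule valuation_integral_SUP_directed[OF \<omega>])
      fix U V assume UV: "U \<in> D" "V \<in> D"
      then obtain W where "W \<in> D" "U \<subseteq> W" "V \<subseteq> W"
        by (rule directed_familyE[OF D(1)])
      then show "\<exists>W\<in>D. \<forall>\<mu>\<in>topspace (Vw X). \<mu> U \<le> \<mu> W \<and> \<mu> V \<le> \<mu> W"
        using D UV by (intro bexI[of _ W]) (auto intro!: valuation_mono)
    qed (use D in \<open>auto simp: directed_family_def intro: ev\<close>)
    finally show ?thesis .
  qed
  ultimately show ?thesis
    unfolding Vw_mult_def by (rule restrict_continuous_valuationI)
qed

lemma Vw_map_continuous_valuation:
  assumes f: "continuous_map X Y f" and \<mu>: "\<mu> \<in> continuous_valuations X"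
  shows "Vw_map X Y f \<mu> \<in> continuous_valuations Y"
proof -
  define P where "P V = {x \<in> topspace X. f x \<in> V}" for V
  have P: "openin X (P V)" if "openin Y V" for V
    unfolding P_def by (rule openin_continuous_map_preimage[OF f that])
  have P_set: "P {} = {}" "P (U \<union> V) = P U \<union> P V" "P (U \<inter> V) = P U \<inter> P V"
    "P (\<Union>D) = (\<Union>W\<in>D. P W)" for U V D
    by (auto simp: P_def)
  have P_mono: "P U \<subseteq> P V" if "U \<subseteq> V" for U V using that by (auto simp: P_def)
  have dir: "\<mu> (\<Union>W\<in>D. P W) = (SUP W\<in>D. \<mu> (P W))"
    if D: "directed_family D" "\<forall>U\<in>D. openin Y U" for D
  proof (rule valuation_UN_directed[OF \<mu>])
    fix U V assume "U \<in> D" "V \<in> D"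
    then obtain W where "W \<in> D" "U \<subseteq> W" "V \<subseteq> W"
      by (rule directed_familyE[OF D(1)])
    then show "\<exists>W\<in>D. P U \<subseteq> P W \<and> P V \<subseteq> P W" by (intro bexI[of _ W] conjI P_mono)
  qed (use D P in \<open>auto simp: directed_family_def\<close>)
  show ?thesis
    unfolding Vw_map_def P_def[symmetric]
    by (intro restrict_continuous_valuationI)
      (simp_all add: P_set valuation_empty[OF \<mu>] valuation_modular[OF \<mu> P P]
        valuation_mono[OF \<mu> P P P_mono] dir)
qed

lemma valuation_integral_Vw_map:
  assumes f: "continuous_map X Y f" and h: "continuous_map Y scott_ennreal h"
  shows "valuation_integral Y (Vw_map X Y f \<mu>) h = valuation_integral X \<mu> (\<lambda>x. h (f x))"
proof -
  have "Vw_map X Y f \<mu> {y \<in> topspace Y. ennreal r < h y} = \<mu> {x \<in> topspace X. ennreal r < h (f x)}"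
    if "0 \<le> r" for r
  proof -
    have "{x \<in> topspace X. f x \<in> topspace Y \<and> ennreal r < h (f x)} = {x \<in> topspace X. ennreal r < h (f x)}"
      using f by (auto simp: continuous_map_def)
    then show ?thesis using openin_superlevel[OF h that] by (simp add: Vw_map_def)
  qed
  then show ?thesis
    unfolding valuation_integral_def by (intro nn_integral_cong) (auto simp: indicator_def)
qed

text \<open>For the evaluation at an open set the exchange is the definition of
  \<open>Vw_mult\<close>. Linearity extends it to the dyadic sums \<open>I n\<close>, and the
  increasing supremum over \<open>n\<close> to the integral of \<open>h\<close>.\<close>

lemma valuation_integral_Vw_mult:
  assumes \<omega>: "\<omega> \<in> continuous_valuations (Vw X)" and h: "continuous_map X scott_ennreal h"
  shows "valuation_integral X (Vw_mult X \<omega>) h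
    = valuation_integral (Vw X) \<omega> (\<lambda>\<mu>. valuation_integral X \<mu> h)"
proof -
  note ev = continuous_map_valuation_eval[OF openin_dyadic_level[OF h]]
  define I where "I n \<mu> = dyadic_sum (\<lambda>r. \<mu> {x \<in> topspace X. ennreal r < h x}) n" for n \<mu>
  have I_eq: "I n = (\<lambda>\<mu>. ennreal (1 / 2 ^ n) * (\<Sum>k<n * 2 ^ n. \<mu> (dyadic_level X h n k)))" for n
    unfolding I_def dyadic_sum_eq_sum_level ..
  have I_cont: "continuous_map (Vw X) scott_ennreal (I n)" for n
    unfolding I_eq by (intro continuous_map_scott_ennreal_cmult continuous_map_scott_ennreal_sum ev)
  have "I n (Vw_mult X \<omega>) = valuation_integral (Vw X) \<omega> (I n)" for n
    unfolding I_eq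
    by (simp add: Vw_mult_def openin_dyadic_level[OF h] valuation_integral_cmult[OF \<omega>]
        valuation_integral_sum[OF \<omega>] continuous_map_scott_ennreal_sum ev)
  then have "valuation_integral X (Vw_mult X \<omega>) h = (SUP n. valuation_integral (Vw X) \<omega> (I n))"
    by (simp add: valuation_integral_dyadic[OF Vw_mult_continuous_valuation[OF \<omega>] h] flip: I_def)
  also have "\<dots> = valuation_integral (Vw X) \<omega> (\<lambda>\<mu>. SUP n. I n \<mu>)"
  proof (rule valuation_integral_SUP_incseq[OF \<omega> I_cont, symmetric])
    fix \<mu> assume "\<mu> \<in> topspace (Vw X)"
    then have \<mu>: "\<mu> \<in> continuous_valuations X" by simp
    show "incseq (\<lambda>n. I n \<mu>)"
      unfolding I_def
    proof (rule incseq_dyadic_sum)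
      fix r s :: real assume "0 \<le> r" "r \<le> s"
      then show "\<mu> {x \<in> topspace X. ennreal s < h x} \<le> \<mu> {x \<in> topspace X. ennreal r < h x}"
        by (intro valuation_mono[OF \<mu>] openin_superlevel h) (auto intro: le_less_trans[OF ennreal_leI])
    qed
  qed
  also have "\<dots> = valuation_integral (Vw X) \<omega> (\<lambda>\<mu>. valuation_integral X \<mu> h)"
    by (intro valuation_integral_cong) (simp add: I_def valuation_integral_dyadic[OF _ h])
  finally show ?thesis .
qed

section \<open>Valuations with the values 0 and 1\<close>

lemma valuation_integral_two_valued:
  assumes "\<And>r. 0 \<le> r \<Longrightarrow> \<mu> {x \<in> topspace X. ennreal r < h x} = (if ennreal r < y then 1 else 0)"
  shows "valuation_integral X \<mu> h = y"
proof -
  have "valuation_integral X \<mu> h = (\<integral>\<^sup>+ r\<in>{0..}. (if ennreal r < y then 1 else 0) \<partial>lborel)"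
    unfolding valuation_integral_def by (intro nn_integral_cong) (auto simp: indicator_def assms)
  then show ?thesis by (simp add: nn_integral_superlevel)
qed

lemma valuation_integral_dirac:
  assumes "continuous_map X scott_ennreal h" "x \<in> topspace X"
  shows "valuation_integral X (dirac_valuation X x) h = h x"
  using assms openin_superlevel[OF assms(1)]
  by (intro valuation_integral_two_valued) (simp add: dirac_valuation_def)

text \<open>A singleton \<open>F\<close> gives a Dirac valuation. For irreducible closed
  \<open>F\<close> it acts as the point mass at a generic point whose existence is still to be
  shown.\<close>

definition meet_valuation :: "'a topology \<Rightarrow> 'a set \<Rightarrow> 'a set \<Rightarrow> ennreal" where
  "meet_valuation X F = (\<lambda>U\<in>{U. openin X U}. if U \<inter> F \<noteq> {} then 1 else 0)"

text \<open>Modularity could fail only where two open sets meet \<open>F\<close> and their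
  intersection does not, which \<open>prime\<close> excludes. A union meets \<open>F\<close> exactly
  when a member does, whence continuity.\<close>

lemma meet_valuation_continuous_valuation:
  assumes prime: "\<And>U V. openin X U \<Longrightarrow> openin X V \<Longrightarrow> U \<inter> F \<noteq> {} \<Longrightarrow> V \<inter> F \<noteq> {} \<Longrightarrow> U \<inter> V \<inter> F \<noteq> {}"
  shows "meet_valuation X F \<in> continuous_valuations X"
proof -
  have "(if \<Union>D \<inter> F \<noteq> {} then 1 else 0) = (SUP U\<in>D. if U \<inter> F \<noteq> {} then 1 else (0 :: ennreal))"
    if "directed_family D" for D
  proof (cases "\<exists>U\<in>D. U \<inter> F \<noteq> {}")
    case True
    then obtain U where "U \<in> D" "U \<inter> F \<noteq> {}" by blast
    then have "1 \<le> (SUP U\<in>D. if U \<inter> F \<noteq> {} then 1 else (0 :: ennreal))"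
      by (intro SUP_upper2[of U]) simp_all
    then have "(SUP U\<in>D. if U \<inter> F \<noteq> {} then 1 else (0 :: ennreal)) = 1"
      by (intro antisym SUP_least) auto
    then show ?thesis using True by auto
  next
    case False
    then have "(SUP U\<in>D. if U \<inter> F \<noteq> {} then 1 else (0 :: ennreal)) = (SUP U\<in>D. 0)"
      by (intro SUP_cong) auto
    then show ?thesis using False that by (auto simp: directed_family_def)
  qed
  moreover have "(if U \<inter> F \<noteq> {} then 1 else 0) + (if V \<inter> F \<noteq> {} then 1 else 0)
      = (if (U \<union> V) \<inter> F \<noteq> {} then 1 else 0) + (if U \<inter> V \<inter> F \<noteq> {} then 1 else (0 :: ennreal))"
    if "openin X U" "openin X V" for U V
    using prime[OF that] by (auto simp: Int_Un_distrib2)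
  ultimately show ?thesis
    unfolding meet_valuation_def by (intro restrict_continuous_valuationI) auto
qed

lemma dirac_valuation_continuous_valuation:
  "dirac_valuation X x \<in> continuous_valuations X"
  using meet_valuation_continuous_valuation[of X "{x}"]
  by (simp add: meet_valuation_def dirac_valuation_def)

lemma valuation_integral_meet_valuation:
  assumes "continuous_map X scott_ennreal h" "F \<subseteq> topspace X"
  shows "valuation_integral X (meet_valuation X F) h = (SUP x\<in>F. h x)"
  using assms(2) openin_superlevel[OF assms(1)]
  by (intro valuation_integral_two_valued) (auto simp: meet_valuation_def less_SUP_iff)

text \<open>Otherwise the complements of \<open>U\<close> and \<open>V\<close> would cover
  \<open>F\<close>, and one of them alone would contain it.\<close>

lemma irreducible_closedin_meets_Int:
  assumes F: "irreducible_closedin X F" and U: "openin X U" "openin X V"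
    and ne: "U \<inter> F \<noteq> {}" "V \<inter> F \<noteq> {}"
  shows "U \<inter> V \<inter> F \<noteq> {}"
proof
  assume *: "U \<inter> V \<inter> F = {}"
  have sub: "F \<subseteq> topspace X" using F by (auto simp: irreducible_closedin_def dest: closedin_subset)
  have "closedin X (topspace X - U)" "closedin X (topspace X - V)" using U by auto
  moreover have "F \<subseteq> (topspace X - U) \<union> (topspace X - V)" using * sub by auto
  ultimately have "F \<subseteq> topspace X - U \<or> F \<subseteq> topspace X - V"
    using F by (simp add: irreducible_closedin_def)
  then show False using ne by auto
qed

section \<open>Gauges of open half-spaces\<close>

text \<open>A Minkowski functional with a supremum in place of the infimum, as \<open>H\<close> is
  to stay away from the zero. A ray that misses \<open>H\<close> gets the empty supremum
  \<open>0\<close>.\<close>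

definition cone_gauge :: "(real \<Rightarrow> 'a \<Rightarrow> 'a) \<Rightarrow> 'a set \<Rightarrow> 'a \<Rightarrow> ennreal" where
  "cone_gauge smul H x = (SUP a\<in>{a. 0 < a \<and> smul (1 / a) x \<in> H}. ennreal a)"

section \<open>Open sets along rays of a semitopological cone\<close>

locale semitop_cone =
  fixes X :: "'a topology" and add zero smul
  assumes semitop: "semitopological_cone X add zero smul"
begin

sublocale rplus_cone "topspace X" add zero smul
  using semitop by (simp add: semitopological_cone_def)

lemma continuous_add: "a \<in> topspace X \<Longrightarrow> continuous_map X X (add a)"
  using semitop by (simp add: semitopological_cone_def)

lemma continuous_smul: "0 \<le> r \<Longrightarrow> continuous_map X X (smul r)"
  using semitop by (simp add: semitopological_cone_def)

lemma continuous_ray: "x \<in> topspace X \<Longrightarrow> continuous_map scott_nnreal X (\<lambda>r. smul r x)"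
  using semitop by (simp add: semitopological_cone_def)

lemma add_zero_right: "x \<in> topspace X \<Longrightarrow> add x zero = x"
  using add_commute add_zero zero_closed by metis

text \<open>The map \<open>r \<mapsto> u + r v\<close> pulls \<open>U\<close> back to a Scott open
  set containing \<open>0\<close>; the only one is the whole half-line, and it contains
  \<open>1\<close>.\<close>

lemma open_add_closed:
  assumes U: "openin X U" and u: "u \<in> U" and v: "v \<in> topspace X"
  shows "add u v \<in> U"
proof -
  have u_top: "u \<in> topspace X" using U u openin_subset by blast
  have "continuous_map scott_nnreal X (add u \<circ> (\<lambda>r. smul r v))"
    by (rule continuous_map_compose[OF continuous_ray[OF v] continuous_add[OF u_top]])
  from openin_continuous_map_preimage[OF this U]
  have "openin scott_nnreal {r \<in> {0..}. add u (smul r v) \<in> U}" by simp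
  moreover have "0 \<in> {r \<in> {0..}. add u (smul r v) \<in> U}"
    using u u_top v by (simp add: zero_smul add_zero_right)
  ultimately have "{r \<in> {0..}. add u (smul r v) \<in> U} = {0..}"
    unfolding openin_scott_nnreal_iff
    by (elim disjE exE conjE) (simp_all only: greaterThan_iff empty_iff not_less[symmetric] not_True_eq_False)
  then have "1 \<in> {r \<in> {0..}. add u (smul r v) \<in> U}" by auto
  then show ?thesis using v by (simp add: one_smul)
qed

text \<open>The part of the ray inside \<open>U\<close> is Scott open, nonempty and without
  \<open>0\<close>, hence an open half-line with threshold \<open>t\<close>.\<close>

lemma open_ray:
  assumes U: "openin X U" and "zero \<notin> U" and x: "x \<in> topspace X" and r: "0 \<le> r" "smul r x \<in> U"
  obtains t where "0 \<le> t" "t < r" "\<And>s. 0 \<le> s \<Longrightarrow> smul s x \<in> U \<longleftrightarrow> t < s"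
proof -
  define R where "R = {s \<in> {0..}. smul s x \<in> U}"
  have "openin scott_nnreal R"
    using openin_continuous_map_preimage[OF continuous_ray[OF x] U] by (simp add: R_def)
  moreover have "r \<in> R" "0 \<notin> R"
    using r x \<open>zero \<notin> U\<close> by (auto simp: R_def zero_smul)
  ultimately obtain t where t: "0 \<le> t" "R = {t<..}"
    unfolding openin_scott_nnreal_iff by auto
  have iff: "smul s x \<in> U \<longleftrightarrow> t < s" if "0 \<le> s" for s
  proof -
    have "s \<in> R \<longleftrightarrow> t < s" by (simp add: t)
    then show ?thesis using that by (simp add: R_def)
  qed
  then show ?thesis using that t r by blast
qed

lemma scaled_combination:
  assumes "x \<in> topspace X" "y \<in> topspace X" "0 < a" "0 < b"
  shows "add (smul (a / (a + b)) (smul (1 / a) x)) (smul (1 - a / (a + b)) (smul (1 / b) y))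
    = smul (1 / (a + b)) (add x y)"
proof -
  have 1: "smul (a / (a + b)) (smul (1 / a) x) = smul (1 / (a + b)) x"
    using assms smul_smul[of "a / (a + b)" "1 / a" x] by simp
  have "1 - a / (a + b) = b / (a + b)" using assms by (simp add: field_simps)
  then have 2: "smul (1 - a / (a + b)) (smul (1 / b) y) = smul (1 / (a + b)) y"
    using assms smul_smul[of "b / (a + b)" "1 / b" y] by simp
  show ?thesis unfolding 1 2 using assms by (simp add: smul_add)
qed

text \<open>The weights \<open>a / (a + b)\<close> and \<open>b / (a + b)\<close> turn both scalings
  into \<open>1 / (a + b)\<close>. Applied to \<open>H\<close> this gives superadditivity of the
  gauge, applied to the complement subadditivity.\<close>

lemma cone_convex_scaled:
  assumes "cone_convex add smul A" "x \<in> topspace X" "y \<in> topspace X" "0 < a" "0 < b"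
    and "smul (1 / a) x \<in> A" "smul (1 / b) y \<in> A"
  shows "smul (1 / (a + b)) (add x y) \<in> A"
proof -
  have "a / (a + b) \<in> {0..1}" using assms by simp
  then have "add (smul (a / (a + b)) (smul (1 / a) x)) (smul (1 - a / (a + b)) (smul (1 / b) y)) \<in> A"
    using assms(1,6,7) unfolding cone_convex_def by blast
  then show ?thesis using assms by (simp add: scaled_combination)
qed

section \<open>Linearity and lower semi-continuity of the gauge\<close>

context
  fixes H
  assumes open_H: "openin X H" and half_H: "half_space (topspace X) add smul H" and zero_H: "zero \<notin> H"
begin

text \<open>Beyond a threshold \<open>t\<close> the ray stays in \<open>H\<close>, which gives one
  direction. For the other, \<open>t < 1 / a\<close> leaves room for an \<open>s\<close> in between,
  and \<open>1 / s\<close> is an admissible scale above \<open>a\<close>.\<close>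

lemma less_cone_gauge_iff:
  assumes x: "x \<in> topspace X" and a: "0 < a"
  shows "ennreal a < cone_gauge smul H x \<longleftrightarrow> smul (1 / a) x \<in> H"
proof
  assume "ennreal a < cone_gauge smul H x"
  then obtain b where b: "0 < b" "smul (1 / b) x \<in> H" "ennreal a < ennreal b"
    by (auto simp: cone_gauge_def less_SUP_iff)
  then have "1 / b < 1 / a" using a by (simp add: ennreal_less_iff field_simps)
  moreover obtain t where "0 \<le> t" "t < 1 / b" "\<And>s. 0 \<le> s \<Longrightarrow> smul s x \<in> H \<longleftrightarrow> t < s"
    using open_ray[OF open_H zero_H x _ b(2)] b by auto
  ultimately show "smul (1 / a) x \<in> H" using a by simp
next
  assume ax: "smul (1 / a) x \<in> H"
  obtain t where t: "0 \<le> t" "t < 1 / a" "\<And>s. 0 \<le> s \<Longrightarrow> smul s x \<in> H \<longleftrightarrow> t < s"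
    using open_ray[OF open_H zero_H x _ ax] a by auto
  then obtain s where s: "t < s" "s < 1 / a" using dense by blast
  then have "0 < s" "a < 1 / s" using t a by (auto simp: field_simps)
  then have "ennreal (1 / s) \<le> cone_gauge smul H x"
    unfolding cone_gauge_def using t s by (intro SUP_upper) simp
  moreover have "ennreal a < ennreal (1 / s)" using \<open>a < 1 / s\<close> a by (simp add: ennreal_less_iff)
  ultimately show "ennreal a < cone_gauge smul H x" by simp
qed

lemma cone_gauge_smul:
  assumes r: "0 \<le> r" and x: "x \<in> topspace X"
  shows "cone_gauge smul H (smul r x) = ennreal r * cone_gauge smul H x"
proof (cases "r = 0")
  case True
  have "smul (1 / a) zero \<notin> H" if "0 < a" for a
    using zero_H that by (simp add: smul_zero)
  then have no: "{a. 0 < a \<and> smul (1 / a) zero \<in> H} = {}" by blast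
  have "cone_gauge smul H zero = 0" unfolding cone_gauge_def no by (simp add: bot_ennreal)
  then show ?thesis using True x by (simp add: zero_smul)
next
  case False
  then have r: "0 < r" using r by simp
  have iff: "ennreal a < cone_gauge smul H (smul r x) \<longleftrightarrow> ennreal a < ennreal r * cone_gauge smul H x"
    if a: "0 < a" for a
  proof -
    have "ennreal a < cone_gauge smul H (smul r x) \<longleftrightarrow> smul (1 / a) (smul r x) \<in> H"
      using r x a by (intro less_cone_gauge_iff smul_closed) auto
    also have "smul (1 / a) (smul r x) = smul (1 / (a / r)) x"
      using smul_smul[of "1 / a" r x] r x a by simp
    also have "\<dots> \<in> H \<longleftrightarrow> ennreal (a / r) < cone_gauge smul H x"
      using r x a by (intro less_cone_gauge_iff[symmetric]) auto
    finally show ?thesis using ennreal_less_mult_left_iff[OF r] by simp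
  qed
  show ?thesis
    by (rule antisym; rule ennreal_superlevel_leI; rule less_imp_le) (use iff in blast)+
qed

lemma cone_gauge_add:
  assumes x: "x \<in> topspace X" and y: "y \<in> topspace X"
  shows "cone_gauge smul H (add x y) = cone_gauge smul H x + cone_gauge smul H y"
proof (rule antisym)
  have xy: "add x y \<in> topspace X" using x y by (rule add_closed)
  let ?g = "cone_gauge smul H"
  \<comment> \<open>If one gauge alone exceeds \<open>c\<close>, the sum does too because open sets
    are closed under adding points. This covers a summand of gauge \<open>0\<close>, which convexity
    of \<open>H\<close> does not reach.\<close>
  have left: "ennreal c < ?g (add u v)" if "0 < c" "u \<in> topspace X" "v \<in> topspace X" "ennreal c < ?g u" for c u v
    using that less_cone_gauge_iff[of u c] less_cone_gauge_iff[of "add u v" c]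
    by (simp add: add_closed smul_add open_add_closed[OF open_H] smul_closed)
  show "?g x + ?g y \<le> ?g (add x y)"
  proof (rule ennreal_superlevel_leI)
    fix c assume c: "0 < c" "ennreal c < ?g x + ?g y"
    consider "ennreal c < ?g x" | "ennreal c < ?g y" | "\<not> ennreal c < ?g x" "\<not> ennreal c < ?g y" by blast
    then have "ennreal c < ?g (add x y)"
    proof cases
      case 2
      then show ?thesis using left[of c y x] c x y add_commute by metis
    next
      case 3
      then obtain a b where ab: "0 \<le> a" "0 \<le> b" "ennreal a < ?g x" "ennreal b < ?g y"
        "ennreal c < ennreal a + ennreal b"
        using ennreal_less_add_obtain[OF c(2)] by auto
      \<comment> \<open>If \<open>a\<close> were \<open>0\<close>, then \<open>c < b\<close> and so
        \<open>?g y\<close> alone would exceed \<open>c\<close>, against the case; likewise for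
        \<open>b\<close>.\<close>
      have "a \<noteq> 0" "b \<noteq> 0" using ab 3 by (auto dest: less_trans)
      then have pos: "0 < a" "0 < b" using ab by auto
      have "cone_convex add smul H" using half_H by (simp add: half_space_def)
      then have "smul (1 / (a + b)) (add x y) \<in> H"
        using ab pos x y by (intro cone_convex_scaled) (simp_all add: less_cone_gauge_iff)
      then have "ennreal (a + b) < ?g (add x y)"
        using pos by (subst less_cone_gauge_iff[OF xy]) auto
      moreover have "ennreal c < ennreal (a + b)" using ab by simp
      ultimately show ?thesis by (rule less_trans[rotated])
    qed (use left c x y in blast)
    then show "ennreal c \<le> ?g (add x y)" by simp
  qed
  show "?g (add x y) \<le> ?g x + ?g y"
  proof (rule ennreal_superlevel_leI, rule ccontr)
    fix c assume c: "0 < c" "ennreal c < ?g (add x y)" "\<not> ennreal c \<le> ?g x + ?g y"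
    then have lt: "?g x + ?g y < ennreal c" by simp
    then have "?g x + ?g y < top" by (rule less_trans) simp
    then obtain u v where u: "0 \<le> u" "?g x = ennreal u" and v: "0 \<le> v" "?g y = ennreal v"
      by (cases "?g x"; cases "?g y") auto
    have uv: "u + v < c" using lt u v by (simp add: ennreal_less_iff flip: ennreal_plus)
    \<comment> \<open>Half of the gap is added to each gauge: the levels \<open>u + d\<close> and
      \<open>v + d\<close> are positive, are not exceeded by the gauges, and add up to
      \<open>c\<close>. So both scaled points lie in the convex complement.\<close>
    define d where "d = (c - u - v) / 2"
    have d: "0 < d" "(u + d) + (v + d) = c" using uv by (auto simp: d_def field_simps)
    have pos: "0 < u + d" "0 < v + d" using u v d by auto
    have "\<not> ennreal (u + d) < ?g x" "\<not> ennreal (v + d) < ?g y"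
      using u v d by (simp_all add: ennreal_less_iff del: ennreal_plus)
    then have "smul (1 / (u + d)) x \<in> topspace X - H" "smul (1 / (v + d)) y \<in> topspace X - H"
      using less_cone_gauge_iff[OF x pos(1)] less_cone_gauge_iff[OF y pos(2)] pos x y
      by (simp_all add: smul_closed)
    moreover have "cone_convex add smul (topspace X - H)" using half_H by (simp add: half_space_def)
    ultimately have "smul (1 / (u + d + (v + d))) (add x y) \<in> topspace X - H"
      using pos x y by (intro cone_convex_scaled) auto
    then show False using c less_cone_gauge_iff[OF xy c(1)] by (simp add: d)
  qed
qed

lemma linear_cone_gauge: "linear_to_ennreal (topspace X) add smul (cone_gauge smul H)"
  unfolding linear_to_ennreal_def by (simp add: cone_gauge_add cone_gauge_smul smul_closed)

lemma continuous_cone_gauge: "continuous_map X scott_ennreal (cone_gauge smul H)"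
  unfolding continuous_map_scott_ennreal_iff
proof (intro allI impI)
  fix r :: real assume r: "0 \<le> r"
  have pos: "openin X {x \<in> topspace X. ennreal a < cone_gauge smul H x}" if a: "0 < a" for a
  proof -
    have "{x \<in> topspace X. ennreal a < cone_gauge smul H x} = {x \<in> topspace X. smul (1 / a) x \<in> H}"
      using a by (auto simp: less_cone_gauge_iff)
    then show ?thesis
      using openin_continuous_map_preimage[OF continuous_smul open_H, of "1 / a"] a by simp
  qed
  \<comment> \<open>The level \<open>0\<close> has no description by scaling \<open>H\<close>, so
    the superlevel set at \<open>r\<close> is exhausted by those at the positive levels
    \<open>a > r\<close>.\<close>
  have "openin X (\<Union>a\<in>{r<..}. {x \<in> topspace X. ennreal a < cone_gauge smul H x})"
    using r by (intro openin_Union) (auto intro!: pos)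
  also have "(\<Union>a\<in>{r<..}. {x \<in> topspace X. ennreal a < cone_gauge smul H x})
      = {x \<in> topspace X. ennreal r < cone_gauge smul H x}"
  proof (intro equalityI subsetI)
    fix x assume x: "x \<in> {x \<in> topspace X. ennreal r < cone_gauge smul H x}"
    then obtain a where "0 \<le> a" "ennreal r < ennreal a" "ennreal a < cone_gauge smul H x"
      by (auto elim: ennreal_less_obtain)
    then show "x \<in> (\<Union>a\<in>{r<..}. {x \<in> topspace X. ennreal a < cone_gauge smul H x})"
      using x r by (auto simp: ennreal_less_iff)
  qed (auto intro: le_less_trans[OF ennreal_leI[OF less_imp_le]])
  finally show "openin X {x \<in> topspace X. ennreal r < cone_gauge smul H x}" .
qed

lemma half_space_eq_superlevel: "H = {x \<in> topspace X. 1 < cone_gauge smul H x}"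
  using less_cone_gauge_iff[of _ 1] openin_subset[OF open_H] by (auto simp: one_smul)

end

lemma open_half_space_cases:
  assumes H: "openin X H" "half_space (topspace X) add smul H"
  obtains "H = topspace X"
  | \<Lambda> where "linear_to_ennreal (topspace X) add smul \<Lambda>" "continuous_map X scott_ennreal \<Lambda>"
      "H = {x \<in> topspace X. 1 < \<Lambda> x}"
proof (cases "zero \<in> H")
  case True
  have "x \<in> H" if "x \<in> topspace X" for x
    using open_add_closed[OF H(1) True that] that by (simp add: add_zero)
  then show ?thesis using that(1) openin_subset[OF H(1)] by blast
next
  case False
  show ?thesis
    using linear_cone_gauge[OF H False] continuous_cone_gauge[OF H False] half_space_eq_superlevel[OF H False]
    by (rule that(2))
qed

end

section \<open>Barycentre maps\<close>

locale loc_linear_cone = semitop_cone X add zero smul for X :: "'a topology" and add zero smul +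
  assumes loc_linear: "locally_linear_cone X add zero smul"
begin

abbreviation lsc_linear :: "('a \<Rightarrow> ennreal) \<Rightarrow> bool" where
  "lsc_linear \<Lambda> \<equiv> linear_to_ennreal (topspace X) add smul \<Lambda> \<and> continuous_map X scott_ennreal \<Lambda>"

lemma subbase_superlevels:
  obtains \<S> where "X = topology_generated_by \<S>"
    "\<And>A. A \<in> \<S> \<Longrightarrow> A = topspace X \<or> (\<exists>\<Lambda>. lsc_linear \<Lambda> \<and> A = {x \<in> topspace X. 1 < \<Lambda> x})"
proof -
  obtain \<S> where \<S>: "\<forall>A\<in>\<S>. openin X A \<and> half_space (topspace X) add smul A" "X = topology_generated_by \<S>"
    using loc_linear unfolding locally_linear_cone_def by blast
  have "A = topspace X \<or> (\<exists>\<Lambda>. lsc_linear \<Lambda> \<and> A = {x \<in> topspace X. 1 < \<Lambda> x})" if "A \<in> \<S>" for A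
  proof (rule open_half_space_cases[of A])
    show "openin X A" "half_space (topspace X) add smul A" using \<S>(1) that by auto
  qed blast+
  with \<S>(2) show ?thesis by (rule that)
qed

text \<open>Continuity is tested on the subbase, where a member is either the whole cone or a
  superlevel set at level 1 of a linear lower semi-continuous map.\<close>

lemma continuous_map_into_cone:
  assumes f: "f ` topspace Y \<subseteq> topspace X"
    and lev: "\<And>\<Lambda>. lsc_linear \<Lambda> \<Longrightarrow> openin Y {y \<in> topspace Y. 1 < \<Lambda> (f y)}"
  shows "continuous_map Y X f"
proof -
  obtain \<S> where \<S>: "X = topology_generated_by \<S>"
    "\<And>A. A \<in> \<S> \<Longrightarrow> A = topspace X \<or> (\<exists>\<Lambda>. lsc_linear \<Lambda> \<and> A = {x \<in> topspace X. 1 < \<Lambda> x})"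
    by (rule subbase_superlevels) blast
  have "openin Y (f -` A \<inter> topspace Y)" if A: "A \<in> \<S>" for A
    using \<S>(2)[OF A]
  proof (elim disjE exE conjE)
    assume "A = topspace X"
    then have "f -` A \<inter> topspace Y = topspace Y" using f by blast
    then show ?thesis by simp
  next
    fix \<Lambda> assume \<Lambda>: "linear_to_ennreal (topspace X) add smul \<Lambda>" "continuous_map X scott_ennreal \<Lambda>"
      and "A = {x \<in> topspace X. 1 < \<Lambda> x}"
    then have "f -` A \<inter> topspace Y = {y \<in> topspace Y. 1 < \<Lambda> (f y)}" using f by auto
    then show ?thesis using lev \<Lambda> by simp
  qed
  moreover have "f ` topspace Y \<subseteq> \<Union>\<S>"
    using f \<S>(1) topology_generated_by_topspace by metis
  ultimately have "continuous_map Y (topology_generated_by \<S>) f"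
    by (simp add: continuous_on_generated_topo_iff)
  then show ?thesis using \<S>(1) by simp
qed

text \<open>Reduces statements about all open sets to values of linear lower semi-continuous maps;
  it serves to separate points and to recognise generic points.\<close>

lemma open_induct_lsc_linear [consumes 1, case_names topspace superlevel Int Union]:
  assumes "openin X U"
    and "P (topspace X)"
    and "\<And>\<Lambda>. lsc_linear \<Lambda> \<Longrightarrow> P {x \<in> topspace X. 1 < \<Lambda> x}"
    and "\<And>U V. openin X U \<Longrightarrow> openin X V \<Longrightarrow> P U \<Longrightarrow> P V \<Longrightarrow> P (U \<inter> V)"
    and "\<And>K. (\<And>U. U \<in> K \<Longrightarrow> P U) \<Longrightarrow> P (\<Union>K)"
  shows "P U"
proof -
  obtain \<S> where \<S>: "X = topology_generated_by \<S>"
    "\<And>A. A \<in> \<S> \<Longrightarrow> A = topspace X \<or> (\<exists>\<Lambda>. lsc_linear \<Lambda> \<and> A = {x \<in> topspace X. 1 < \<Lambda> x})"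
    by (rule subbase_superlevels) blast
  have op: "openin X V \<longleftrightarrow> generate_topology_on \<S> V" for V
    by (subst \<S>(1)) (rule openin_topology_generated_by_iff)
  have "generate_topology_on \<S> U" using assms(1) op by simp
  then show "P U"
  proof induction
    case Empty
    show ?case using assms(5)[of "{}"] by simp
  next
    case (Int U V)
    then show ?case using assms(4) op by blast
  next
    case (UN K)
    then show ?case using assms(5) by blast
  next
    case (Basis A)
    then show ?case using \<S>(2)[OF Basis] assms(2,3) by blast
  qed
qed

lemma t0: "t0_space X"
  using semitop by (simp add: semitopological_cone_def)

text \<open>Points on which all these maps agree lie in the same subbasic sets, hence in the same
  open sets, and the space is \<open>T_0\<close>.\<close>

lemma lsc_linear_separating:
  assumes "x \<in> topspace X" "y \<in> topspace X" "\<And>\<Lambda>. lsc_linear \<Lambda> \<Longrightarrow> \<Lambda> x = \<Lambda> y"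
  shows "x = y"
proof (rule ccontr)
  assume "x \<noteq> y"
  then obtain U where U: "openin X U" "x \<notin> U \<longleftrightarrow> y \<in> U"
    using t0 assms(1,2) unfolding t0_space_def by blast
  from U(1) have "x \<in> U \<longleftrightarrow> y \<in> U"
  proof (induction rule: open_induct_lsc_linear)
    case (superlevel \<Lambda>)
    then have "\<Lambda> x = \<Lambda> y" by (rule assms(3))
    then show ?case using assms(1,2) by simp
  qed (use assms(1,2) in auto)
  then show False using U(2) by simp
qed

lemma linear_to_ennreal_add:
  assumes "linear_to_ennreal (topspace X) add smul \<Lambda>" "x \<in> topspace X" "y \<in> topspace X"
  shows "\<Lambda> (add x y) = \<Lambda> x + \<Lambda> y"
proof -
  have "\<Lambda> (add (smul 1 x) (smul 1 y)) = ennreal 1 * \<Lambda> x + ennreal 1 * \<Lambda> y"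
    using assms unfolding linear_to_ennreal_def by (metis zero_le_one)
  then show ?thesis using assms by (simp add: one_smul)
qed

lemma linear_to_ennreal_smul:
  assumes "linear_to_ennreal (topspace X) add smul \<Lambda>" "x \<in> topspace X" "0 \<le> r"
  shows "\<Lambda> (smul r x) = ennreal r * \<Lambda> x"
proof -
  have "\<Lambda> (add (smul r x) (smul 0 x)) = ennreal r * \<Lambda> x + ennreal 0 * \<Lambda> x"
    using assms unfolding linear_to_ennreal_def by (metis order_refl)
  then show ?thesis using assms by (simp add: zero_smul add_zero_right smul_closed)
qed

section \<open>Joint continuity of the cone operations\<close>

lemma is_topological_cone: "topological_cone X add zero smul"
  unfolding topological_cone_def
proof (intro conjI)
  show "rplus_cone (topspace X) add zero smul" by (rule rplus_cone_axioms)
  show "t0_space X" by (rule t0)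
  show "continuous_map (prod_topology X X) X (\<lambda>(x, y). add x y)"
  proof (rule continuous_map_into_cone)
    show "(\<lambda>(x, y). add x y) ` topspace (prod_topology X X) \<subseteq> topspace X"
      by (auto intro: add_closed)
    fix \<Lambda> assume \<Lambda>: "lsc_linear \<Lambda>"
    \<comment> \<open>By linearity, \<open>\<Lambda>\<close> after addition is a sum of two lower
      semi-continuous maps of the pair.\<close>
    have "continuous_map (prod_topology X X) scott_ennreal (\<lambda>p. \<Lambda> (fst p) + \<Lambda> (snd p))"
      using \<Lambda> by (intro continuous_map_scott_ennreal_add)
        (auto intro: continuous_map_compose[unfolded comp_def] continuous_map_fst continuous_map_snd)
    from openin_superlevel[OF this, of 1]
    have "openin (prod_topology X X) {p \<in> topspace (prod_topology X X). 1 < \<Lambda> (fst p) + \<Lambda> (snd p)}"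
      by simp
    also have "{p \<in> topspace (prod_topology X X). 1 < \<Lambda> (fst p) + \<Lambda> (snd p)}
        = {p \<in> topspace (prod_topology X X). 1 < \<Lambda> (case p of (x, y) \<Rightarrow> add x y)}"
      using \<Lambda> by (auto simp: linear_to_ennreal_add)
    finally show "openin (prod_topology X X)
        {p \<in> topspace (prod_topology X X). 1 < \<Lambda> (case p of (x, y) \<Rightarrow> add x y)}" .
  qed
  show "continuous_map (prod_topology scott_nnreal X) X (\<lambda>(r, x). smul r x)"
  proof (rule continuous_map_into_cone)
    show "(\<lambda>(r, x). smul r x) ` topspace (prod_topology scott_nnreal X) \<subseteq> topspace X"
      by (auto intro: smul_closed)
    fix \<Lambda> assume \<Lambda>: "lsc_linear \<Lambda>"
    \<comment> \<open>The condition \<open>1 < r * \<Lambda> x\<close> splits into open rectangles: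
      some \<open>a > 0\<close> satisfies \<open>a < r\<close> and
      \<open>1 / a < \<Lambda> x\<close>.\<close>
    have "openin (prod_topology scott_nnreal X)
        (\<Union>a\<in>{0<..}. {a<..} \<times> {x \<in> topspace X. ennreal (1 / a) < \<Lambda> x})"
      using \<Lambda> by (intro openin_Union)
        (auto simp: openin_prod_Times_iff openin_scott_nnreal_iff intro!: openin_superlevel)
    also have "(\<Union>a\<in>{0<..}. {a<..} \<times> {x \<in> topspace X. ennreal (1 / a) < \<Lambda> x})
        = {p \<in> topspace (prod_topology scott_nnreal X). 1 < \<Lambda> (case p of (r, x) \<Rightarrow> smul r x)}"
    proof (intro equalityI subsetI)
      fix p assume "p \<in> (\<Union>a\<in>{0<..}. {a<..} \<times> {x \<in> topspace X. ennreal (1 / a) < \<Lambda> x})"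
      then obtain a r x where p: "p = (r, x)" "0 < a" "a < r" "x \<in> topspace X" "ennreal (1 / a) < \<Lambda> x"
        by blast
      have "1 / r < 1 / a" using p by (simp add: frac_less2)
      then have "ennreal (1 / r) < \<Lambda> x" using p by (blast intro: le_less_trans[OF ennreal_leI[OF less_imp_le]])
      then have "ennreal 1 < ennreal r * \<Lambda> x" using p by (subst ennreal_less_mult_left_iff) auto
      then show "p \<in> {p \<in> topspace (prod_topology scott_nnreal X). 1 < \<Lambda> (case p of (r, x) \<Rightarrow> smul r x)}"
        using p \<Lambda> by (simp add: linear_to_ennreal_smul)
    next
      fix p assume "p \<in> {p \<in> topspace (prod_topology scott_nnreal X). 1 < \<Lambda> (case p of (r, x) \<Rightarrow> smul r x)}"
      then obtain r x where p: "p = (r, x)" "0 \<le> r" "x \<in> topspace X" "ennreal 1 < ennreal r * \<Lambda> x"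
        using \<Lambda> by (cases p) (auto simp: linear_to_ennreal_smul)
      \<comment> \<open>At \<open>r = 0\<close> the product is \<open>0\<close> even when
        \<open>\<Lambda> x\<close> is infinite, so it cannot exceed \<open>1\<close>.\<close>
      have r: "0 < r" using p by (cases "r = 0") auto
      then have "ennreal (1 / r) < \<Lambda> x" using p by (subst (asm) ennreal_less_mult_left_iff) auto
      then obtain q where q: "0 \<le> q" "ennreal (1 / r) < ennreal q" "ennreal q < \<Lambda> x"
        by (rule ennreal_less_obtain)
      then have "1 / r < q" using r by (simp add: ennreal_less_iff)
      moreover have "0 < q" using calculation r by (simp add: less_trans[of 0 "1 / r"])
      ultimately have "1 / q < r" using r by (simp add: field_simps)
      then show "p \<in> (\<Union>a\<in>{0<..}. {a<..} \<times> {x \<in> topspace X. ennreal (1 / a) < \<Lambda> x})"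
        using p q \<open>0 < q\<close> by (intro UN_I[of "1 / q"]) auto
    qed
    finally show "openin (prod_topology scott_nnreal X)
        {p \<in> topspace (prod_topology scott_nnreal X). 1 < \<Lambda> (case p of (r, x) \<Rightarrow> smul r x)}" .
  qed
qed

section \<open>Sobriety\<close>

lemma sober_space_if_barycentres:
  assumes bary: "\<And>\<nu>. \<nu> \<in> continuous_valuations X \<Longrightarrow> \<exists>b. is_barycentre X add smul \<nu> b"
  shows "sober_space X"
  unfolding sober_space_def
proof (intro allI impI)
  fix F assume F: "irreducible_closedin X F"
  have F_closed: "closedin X F" "F \<noteq> {}" "F \<subseteq> topspace X"
    using F by (auto simp: irreducible_closedin_def dest: closedin_subset)
  have "meet_valuation X F \<in> continuous_valuations X"
    by (rule meet_valuation_continuous_valuation) (rule irreducible_closedin_meets_Int[OF F])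
  then obtain b where b: "is_barycentre X add smul (meet_valuation X F) b" using bary by blast
  then have b_top: "b \<in> topspace X" by (simp add: is_barycentre_def)
  \<comment> \<open>On a superlevel set, \<open>\<Lambda> b\<close> is the supremum of
    \<open>\<Lambda>\<close> over \<open>F\<close>, so it exceeds \<open>1\<close> exactly when some
    point of \<open>F\<close> does. The step for intersections is irreducibility.\<close>
  have b_iff: "b \<in> U \<longleftrightarrow> U \<inter> F \<noteq> {}" if "openin X U" for U
    using that
  proof (induction rule: open_induct_lsc_linear)
    case topspace
    show ?case using F_closed b_top by blast
  next
    case (superlevel \<Lambda>)
    have "\<Lambda> b = (SUP x\<in>F. \<Lambda> x)"
      using b superlevel F_closed(3) by (simp add: is_barycentre_def valuation_integral_meet_valuation)
    then show ?case using b_top F_closed by (auto simp: less_SUP_iff)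
  next
    case (Int U V)
    then show ?case using irreducible_closedin_meets_Int[OF F, of U V] by blast
  qed blast
  have "F = X closure_of {b}"
  proof (intro equalityI subsetI)
    fix x assume "x \<in> F"
    then show "x \<in> X closure_of {b}" using b_iff F_closed(3) by (auto simp: in_closure_of)
  next
    \<comment> \<open>The complement of \<open>F\<close> is open and misses \<open>F\<close>, so it
      does not contain \<open>b\<close>.\<close>
    have "b \<in> F" using b_iff[of "topspace X - F"] F_closed(1) b_top by blast
    then show "x \<in> F" if "x \<in> X closure_of {b}" for x
      using that closure_of_minimal[of "{b}" F X] F_closed(1) by blast
  qed
  moreover have "y = b" if y: "y \<in> topspace X" "F = X closure_of {y}" for y
  proof (rule ccontr)
    assume "y \<noteq> b"
    then obtain U where U: "openin X U" "y \<notin> U \<longleftrightarrow> b \<in> U"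
      using t0 y(1) b_top unfolding t0_space_def by blast
    have "y \<in> U \<longleftrightarrow> b \<in> U"
    proof -
      \<comment> \<open>\<open>calculation\<close> is the equation
        \<open>F = X closure_of {b}\<close>; with the one for \<open>y\<close>, each point lies in
        the closure of the other, so the same open sets contain them.\<close>
      have "y \<in> X closure_of {b}" "b \<in> X closure_of {y}"
        using y b_top calculation closure_of_subset[of "{y}" X] closure_of_subset[of "{b}" X] by auto
      then show ?thesis using U(1) unfolding in_closure_of by blast
    qed
    then show False using U(2) by blast
  qed
  ultimately show "\<exists>!x. x \<in> topspace X \<and> F = X closure_of {x}" using b_top by blast
qed

section \<open>The algebra laws\<close>

lemma barycentre_map_algebra:
  assumes \<beta>: "\<And>\<nu>. \<nu> \<in> continuous_valuations X \<Longrightarrow> is_barycentre X add smul \<nu> (\<beta> \<nu>)"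
  shows "Vw_algebra X \<beta>"
proof -
  have \<beta>_top: "\<beta> \<nu> \<in> topspace X" if "\<nu> \<in> continuous_valuations X" for \<nu>
    using \<beta>[OF that] by (simp add: is_barycentre_def)
  have \<beta>_int: "\<Lambda> (\<beta> \<nu>) = valuation_integral X \<nu> \<Lambda>"
    if "\<nu> \<in> continuous_valuations X" "lsc_linear \<Lambda>" for \<nu> \<Lambda>
    using \<beta>[OF that(1)] that(2) by (simp add: is_barycentre_def)
  have cont: "continuous_map (Vw X) X \<beta>"
  proof (rule continuous_map_into_cone)
    show "\<beta> ` topspace (Vw X) \<subseteq> topspace X" using \<beta>_top by auto
    fix \<Lambda> assume \<Lambda>: "lsc_linear \<Lambda>"
    then have "continuous_map (Vw X) scott_ennreal (\<lambda>\<nu>. valuation_integral X \<nu> \<Lambda>)"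
      by (intro continuous_map_valuation_integral) simp
    from openin_superlevel[OF this, of 1]
    have "openin (Vw X) {\<nu> \<in> topspace (Vw X). 1 < valuation_integral X \<nu> \<Lambda>}" by simp
    also have "{\<nu> \<in> topspace (Vw X). 1 < valuation_integral X \<nu> \<Lambda>} = {\<nu> \<in> topspace (Vw X). 1 < \<Lambda> (\<beta> \<nu>)}"
      using \<beta>_int \<Lambda> by auto
    finally show "openin (Vw X) {\<nu> \<in> topspace (Vw X). 1 < \<Lambda> (\<beta> \<nu>)}" .
  qed
  \<comment> \<open>Linear lower semi-continuous maps separate points, and integrating
    \<open>\<Lambda>\<close> against the Dirac valuation returns \<open>\<Lambda> x\<close>.\<close>
  have unit: "\<beta> (dirac_valuation X x) = x" if x: "x \<in> topspace X" for x
  proof (rule lsc_linear_separating)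
    note d = dirac_valuation_continuous_valuation[of X x]
    show "\<beta> (dirac_valuation X x) \<in> topspace X" by (rule \<beta>_top[OF d])
    show "\<Lambda> (\<beta> (dirac_valuation X x)) = \<Lambda> x" if "lsc_linear \<Lambda>" for \<Lambda>
      using that x by (simp add: \<beta>_int[OF d] valuation_integral_dirac)
  qed (rule x)
  have mult: "\<beta> (Vw_mult X \<omega>) = \<beta> (Vw_map (Vw X) X \<beta> \<omega>)" if \<omega>: "\<omega> \<in> continuous_valuations (Vw X)" for \<omega>
  proof (rule lsc_linear_separating)
    note m = Vw_mult_continuous_valuation[OF \<omega>]
    note v = Vw_map_continuous_valuation[OF cont \<omega>]
    show "\<beta> (Vw_mult X \<omega>) \<in> topspace X" by (rule \<beta>_top[OF m])
    show "\<beta> (Vw_map (Vw X) X \<beta> \<omega>) \<in> topspace X" by (rule \<beta>_top[OF v])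
    fix \<Lambda> assume \<Lambda>: "lsc_linear \<Lambda>"
    \<comment> \<open>First the barycentre of \<open>Vw_mult X \<omega>\<close> and the exchange of
      integrals; then the inner integral is read as \<open>\<Lambda> (\<beta> \<nu>)\<close>, and a
      change of variables along \<open>\<beta>\<close> gives the barycentre of the image
      valuation.\<close>
    have "\<Lambda> (\<beta> (Vw_mult X \<omega>)) = valuation_integral (Vw X) \<omega> (\<lambda>\<nu>. valuation_integral X \<nu> \<Lambda>)"
      using \<Lambda> by (simp add: \<beta>_int[OF m] valuation_integral_Vw_mult[OF \<omega>])
    also have "\<dots> = valuation_integral (Vw X) \<omega> (\<lambda>\<nu>. \<Lambda> (\<beta> \<nu>))"
      using \<Lambda> by (intro valuation_integral_cong) (simp add: \<beta>_int)
    also have "\<dots> = \<Lambda> (\<beta> (Vw_map (Vw X) X \<beta> \<omega>))"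
      using \<Lambda> by (simp add: \<beta>_int[OF v] valuation_integral_Vw_map[OF cont])
    finally show "\<Lambda> (\<beta> (Vw_mult X \<omega>)) = \<Lambda> (\<beta> (Vw_map (Vw X) X \<beta> \<omega>))" .
  qed
  show ?thesis
    unfolding Vw_algebra_def using t0 cont unit mult by simp
qed

end

theorem proposition4p11:
  fixes X :: "'a topology"
    and add :: "'a \<Rightarrow> 'a \<Rightarrow> 'a" and zero :: 'a and smul :: "real \<Rightarrow> 'a \<Rightarrow> 'a"
  assumes "semitopological_cone X add zero smul"
    and "locally_linear_cone X add zero smul"
    and "\<forall>\<nu>\<in>continuous_valuations X. \<exists>b. is_barycentre X add smul \<nu> b"
  shows "(\<forall>\<beta>. (\<forall>\<nu>\<in>continuous_valuations X. is_barycentre X add smul \<nu> (\<beta> \<nu>)) \<longrightarrow> Vw_algebra X \<beta>) \<and>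
         sober_space X \<and> topological_cone X add zero smul"
proof -
  interpret loc_linear_cone X add zero smul
    using assms(1,2) by unfold_locales
  show ?thesis
    using assms(3) barycentre_map_algebra sober_space_if_barycentres is_topological_cone by blast
qed

end
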